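(* Let $X$ be a finite-dimensional real vector space with a positive definite symmetric bilinear form $(\cdot,\cdot)$, used to identify $X$ with its dual, and let $C$ be a closed convex polyhedral cone in $X$ with set of closed faces $\mathcal{F}$. For all $x,y\in X$ there is an equality $$\sum_{F\in\mathcal{F}}\psi_{C+\mathrm{span}(F)}\big(-y,-p_{\mathrm{span}(F)^\perp}(x)\big)\cdot\xi_{F^\circ}\big(p_{\mathrm{span}(F)}(x)\big)=(-1)^{\dim(C)}\,\xi_{C^\circ}(y).$$
   Context: A closed convex polyhedral cone is the set of non-negative linear combinations of a finite set of vectors. $\mathrm{span}(F)$ is the linear span, $\dim(F)=\dim\mathrm{span}(F)$, $F^\circ$ (resp. $C^\circ$) is the relative interior of $F$ (resp. $C$), i.e. the interior in its linear span, and $\xi_S$ is the characteristic function of a set $S$. For a linear subspace $Y\subset X$, $p_Y$ is the orthogonal projection onto $Y$, and $Y^\perp$ its orthogonal complement. The dual cone of a cone $D$ is $D^*=\{\lambda\in X:(\lambda,z)\ge0$ for all $z\in D\}$. For a closed convex polyhedral cone $D$ the function $\psi_D$ on $X\times X^*$, viewed as a function on $X\times X$, is $$\psi_D(u,\lambda)=\sum_{H}(-1)^{\dim(H)}\,\xi_{D+\mathrm{span}(H)}(u)\,\xi_{H^*}(\lambda),$$ the sum being over all closed faces $H$ of $D$. *)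

theory Defs
  imports "HOL-Analysis.Analysis"
begin

text \<open>
  A finite-dimensional real inner product space is represented by a linear subspace \<open>X\<close> of a
  Euclidean space, with the restricted inner product.  Since types of class
  \<open>euclidean_space\<close> have positive dimension, taking \<open>X\<close> to be the whole type would exclude the
  zero space.
\<close>

definition polyhedral_cone :: "'a::real_vector set \<Rightarrow> bool" where
  "polyhedral_cone C \<longleftrightarrow>
     (\<exists>S. finite S \<and> C = {(\<Sum>v\<in>S. c v *\<^sub>R v) |c. \<forall>v\<in>S. 0 \<le> c v})"

text \<open>
  The library relation \<open>face_of\<close> admits the empty face, which is not a face of a cone here;
  the cone itself and its lineality space are faces.  Faces of a closed convex set are
  automatically closed.  Every nonempty face of a cone contains \<open>0\<close>, so its affine hull is its
  linear span and the library's \<open>rel_interior\<close> is the interior in the linear span.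
\<close>

definition cone_faces :: "'a::real_vector set \<Rightarrow> 'a set set" where
  "cone_faces C = {F. F face_of C \<and> F \<noteq> {}}"

definition dual_cone :: "'a::real_inner set \<Rightarrow> 'a set \<Rightarrow> 'a set" where
  "dual_cone X D = {l \<in> X. \<forall>z\<in>D. 0 \<le> l \<bullet> z}"

text \<open>The description is well defined for every linear subspace \<open>Y\<close> of a Euclidean space.\<close>

definition orth_proj :: "'a::euclidean_space set \<Rightarrow> 'a \<Rightarrow> 'a" where
  "orth_proj Y x = (THE y. y \<in> Y \<and> x - y \<in> Y\<^sup>\<bottom>)"

text \<open>
  The sum \<open>D + span H\<close> of sets is the Minkowski sum; \<open>dim H\<close> is the dimension of \<open>span H\<close>.
\<close>

definition psi :: "'a::euclidean_space set \<Rightarrow> 'a set \<Rightarrow> 'a \<Rightarrow> 'a \<Rightarrow> int" where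
  "psi X D u l =
     (\<Sum>H\<in>cone_faces D. (-1) ^ dim H * indicator (D + span H) u * indicator (dual_cone X H) l)"

end

theory Submission
  imports Defs
begin

text \<open>
Write \<open>T K = C + span K\<close> for the tangent cone of \<open>C\<close> at a face \<open>K\<close>.  The faces of \<open>T F\<close> are the
sets \<open>K + span F\<close> for the faces \<open>K\<close> of \<open>C\<close> containing \<open>F\<close>, and the tangent cone of \<open>T F\<close> at
\<open>K + span F\<close> is again \<open>T K\<close> (lemma \<open>psi_tangent_cone\<close>).  So the left-hand side is a double sum
over pairs \<open>F \<subseteq> K\<close>, and after exchanging the two summations the terms \<open>(-1) ^ dim K\<close> and
\<open>- y \<in> T K\<close> depend on \<open>K\<close> only.  For fixed \<open>K\<close>, the two conditions on \<open>x\<close> attached to \<open>F\<close> say that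
the point of \<open>K\<close> nearest to \<open>x\<close> lies in the relative interior of \<open>F\<close>, by the variational
characterization of the nearest point of a cone (\<open>closest_point_in_face_iff\<close>).  The relative
interiors of the faces partition \<open>K\<close>, so exactly one \<open>F\<close> contributes, and the dependence on \<open>x\<close>
disappears (\<open>sum_nearest_point_faces\<close>).

What remains is an Euler relation (\<open>euler_relation_tangent_cones\<close>): the sum of
\<open>(-1) ^ dim K\<close> over the faces \<open>K\<close> with \<open>z \<in> T K\<close> is \<open>(-1) ^ dim C\<close> if \<open>- z\<close> is in the relative
interior of \<open>C\<close>, and \<open>0\<close> otherwise.  For its proof \<open>C\<close> is described by inequalities
\<open>0 \<le> a i \<bullet> x\<close> with \<open>i \<in> I\<close> on a subspace \<open>L\<close>, and each face is represented by its relative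
interior, the cell of points at which exactly the inequalities with index in some \<open>J \<subseteq> I\<close> are
equalities.  Both sides of the relation are valuations: if a hyperplane cuts the cone, the value
for the whole cone plus the value for the slice is the sum of the values for the two halves.  By
induction on the number of inequalities the relation holds for the cone with one inequality
dropped and for the slice; hence it holds for one half if and only if it holds for the other, and
signs of the \<open>a i\<close> may be reversed at will.  If some \<open>a j\<close> depends linearly on the others as
functionals on \<open>L\<close>, a choice of signs makes all coefficients nonpositive; this forces the cone
into the kernel of \<open>a j\<close>, where one inequality fewer is needed.  Otherwise the cone is the product
of a cone with one inequality fewer and a ray, for which both sides can be compared directly.
\<close>

section \<open>Cells of a homogeneous linear system\<close>

definition halfspace_cone :: "'a::euclidean_space set \<Rightarrow> ('i \<Rightarrow> 'a) \<Rightarrow> 'i set \<Rightarrow> 'a set" where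
  "halfspace_cone L a I = {x \<in> L. \<forall>i\<in>I. 0 \<le> a i \<bullet> x}"

definition flat :: "'a::euclidean_space set \<Rightarrow> ('i \<Rightarrow> 'a) \<Rightarrow> 'i set \<Rightarrow> 'a set" where
  "flat L a J = {x \<in> L. \<forall>i\<in>J. a i \<bullet> x = 0}"

text \<open>
For \<open>J \<subseteq> I\<close> this is the set of points of \<open>L\<close> satisfying the system \<open>I\<close> at which \<open>J\<close> is exactly
the set of active inequalities.  It may be empty; the nonempty ones partition the cone.
\<close>

definition open_cell :: "'a::euclidean_space set \<Rightarrow> ('i \<Rightarrow> 'a) \<Rightarrow> 'i set \<Rightarrow> 'i set \<Rightarrow> 'a set" where
  "open_cell L a I J = {x \<in> flat L a J. \<forall>i\<in>I - J. 0 < a i \<bullet> x}"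

lemma subspace_flat: "subspace L \<Longrightarrow> subspace (flat L a J)"
  by (auto simp: flat_def subspace_def inner_add_right)

lemma subspace_Int_kernel: "subspace L \<Longrightarrow> subspace (L \<inter> {x. b \<bullet> x = 0})"
  by (auto simp: subspace_def inner_add_right)

lemma convex_cone_halfspace_cone: "subspace L \<Longrightarrow> convex_cone (halfspace_cone L a I)"
  by (auto simp: convex_cone_iff halfspace_cone_def subspace_def inner_add_right)

lemma aff_dim_convex_cone: "convex_cone C \<Longrightarrow> aff_dim C = int (dim C)"
  by (simp add: aff_dim_zero convex_cone_contains_0 hull_inc)

lemma neg_one_power_dim_kernel:
  fixes W :: "'a::euclidean_space set"
  assumes "subspace W" "w \<in> W" "b \<bullet> w \<noteq> 0"
  shows "(-1 :: int) ^ dim (W \<inter> {x. b \<bullet> x = 0}) = - ((-1) ^ dim W)"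
proof -
  have "0 \<in> W \<inter> {x. b \<bullet> x = 0}"
    using assms by (simp add: subspace_0)
  then have "aff_dim (W \<inter> {x. b \<bullet> x = 0}) = aff_dim W - 1"
    using assms aff_dim_affine_Int_hyperplane[OF subspace_imp_affine[OF assms(1)], of b 0] by auto
  then have "dim W = Suc (dim (W \<inter> {x. b \<bullet> x = 0}))"
    using assms by (simp add: aff_dim_subspace subspace_Int_kernel)
  then show ?thesis by simp
qed

text \<open>
Only finitely many strict inequalities have to survive, so continuity gives a common step size.
\<close>

lemma perturb_positive:
  fixes x w :: "'a::euclidean_space"
  assumes "finite I" "\<forall>i\<in>I. 0 < a i \<bullet> x"
  shows "\<exists>e>0. \<forall>i\<in>I. 0 < a i \<bullet> (x + e *\<^sub>R w) \<and> 0 < a i \<bullet> (x - e *\<^sub>R w)"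
proof -
  have "((\<lambda>t. a i \<bullet> (x + t *\<^sub>R w)) \<longlongrightarrow> a i \<bullet> (x + 0 *\<^sub>R w)) (nhds 0)" for i
    by (intro tendsto_intros filterlim_ident)
  then have "\<forall>i\<in>I. \<forall>\<^sub>F t in nhds 0. 0 < a i \<bullet> (x + t *\<^sub>R w)"
    using assms(2) by (force intro: order_tendstoD(1))
  then have "\<forall>\<^sub>F t in nhds 0. \<forall>i\<in>I. 0 < a i \<bullet> (x + t *\<^sub>R w)"
    using assms(1) by (simp add: eventually_ball_finite)
  then obtain d where "d > 0" "\<And>t. dist t 0 < d \<Longrightarrow> \<forall>i\<in>I. 0 < a i \<bullet> (x + t *\<^sub>R w)"
    by (auto simp: eventually_nhds_metric)
  from this(1) this(2)[of "d / 2"] this(2)[of "- (d / 2)"] show ?thesis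
    by (intro exI[of _ "d / 2"]) (simp add: dist_real_def)
qed

lemma open_cell_perturb:
  assumes "finite I" "subspace L" "x \<in> open_cell L a I J" "w \<in> flat L a J"
  shows "\<exists>e>0. x + e *\<^sub>R w \<in> open_cell L a I J \<and> x - e *\<^sub>R w \<in> open_cell L a I J"
proof -
  have x: "x \<in> flat L a J" "\<forall>i\<in>I - J. 0 < a i \<bullet> x" and fin: "finite (I - J)"
    using assms(1,3) by (auto simp: open_cell_def)
  obtain e where e: "0 < e" "\<forall>i\<in>I - J. 0 < a i \<bullet> (x + e *\<^sub>R w) \<and> 0 < a i \<bullet> (x - e *\<^sub>R w)"
    using perturb_positive[OF fin x(2)] by blast
  moreover have "x + e *\<^sub>R w \<in> flat L a J" "x - e *\<^sub>R w \<in> flat L a J"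
    by (intro subspace_add subspace_diff subspace_scale subspace_flat assms x(1))+
  ultimately show ?thesis
    by (auto simp: open_cell_def)
qed

lemma halfspace_cone_insert:
  "halfspace_cone L a (insert j I) = halfspace_cone L a I \<inter> {x. 0 \<le> a j \<bullet> x}"
  "halfspace_cone (L \<inter> {x. b \<bullet> x = 0}) a I = halfspace_cone L a I \<inter> {x. b \<bullet> x = 0}"
  by (auto simp: halfspace_cone_def)

lemma flat_insert:
  "flat L a (insert j J) = flat L a J \<inter> {x. a j \<bullet> x = 0}"
  "flat (L \<inter> {x. b \<bullet> x = 0}) a J = flat L a J \<inter> {x. b \<bullet> x = 0}"
  by (auto simp: flat_def)

lemma open_cell_insert:
  assumes "j \<notin> I" "J \<subseteq> I"
  shows "open_cell L a (insert j I) J = open_cell L a I J \<inter> {x. 0 < a j \<bullet> x}"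
    and "open_cell L a (insert j I) (insert j J) = open_cell L a I J \<inter> {x. a j \<bullet> x = 0}"
    and "open_cell (L \<inter> {x. a j \<bullet> x = 0}) a I J = open_cell L a I J \<inter> {x. a j \<bullet> x = 0}"
  using assms by (auto simp: open_cell_def flat_def)

lemma halfspace_system_cong:
  assumes "\<And>i. i \<in> I \<Longrightarrow> a i = a' i" "J \<subseteq> I"
  shows "open_cell L a I J = open_cell L a' I J" "flat L a J = flat L a' J"
    "halfspace_cone L a J = halfspace_cone L a' J"
  using assms by (auto simp: open_cell_def flat_def halfspace_cone_def subset_iff)

section \<open>The alternating sum over cells as a valuation\<close>

text \<open>
A nonempty cell is the relative interior of a face \<open>F\<close>; then \<open>flat L a J\<close> is
the span of \<open>F\<close> and \<open>halfspace_cone L a J\<close> is the tangent cone at \<open>F\<close>, because dropping the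
inactive inequalities is the same as looking at the cone near a point of the cell.  So this is the
alternating sum over the faces whose tangent cone contains \<open>z\<close>.  Indexing by active sets instead
of faces makes the effect of an additional inequality computable cell by cell.
\<close>

definition tangent_sum :: "'a::euclidean_space set \<Rightarrow> ('i \<Rightarrow> 'a) \<Rightarrow> 'i set \<Rightarrow> 'a \<Rightarrow> int" where
  "tangent_sum L a I z =
     (\<Sum>J\<in>Pow I. of_bool (open_cell L a I J \<noteq> {}) * (-1) ^ dim (flat L a J)
        * indicator (halfspace_cone L a J) z)"

text \<open>
An additional inequality restricts each cell to its part on the positive side, where the new
inequality is inactive, and adds the part on the hyperplane, where it is active.
\<close>

lemma tangent_sum_insert:
  assumes "finite I" "j \<notin> I"
  shows "tangent_sum L a (insert j I) z =
    (\<Sum>J\<in>Pow I. (of_bool (open_cell L a I J \<inter> {x. 0 < a j \<bullet> x} \<noteq> {}) * (-1) ^ dim (flat L a J)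
       + of_bool (open_cell L a I J \<inter> {x. a j \<bullet> x = 0} \<noteq> {})
         * (-1) ^ dim (flat L a J \<inter> {x. a j \<bullet> x = 0}) * of_bool (0 \<le> a j \<bullet> z))
       * indicator (halfspace_cone L a J) z)"
proof -
  have inj: "inj_on (insert j) (Pow I)"
    using assms(2) by (auto simp: inj_on_def)
  have "tangent_sum L a (insert j I) z =
      (\<Sum>J\<in>Pow I. of_bool (open_cell L a (insert j I) J \<noteq> {}) * (-1) ^ dim (flat L a J)
        * indicator (halfspace_cone L a J) z)
    + (\<Sum>J\<in>Pow I. of_bool (open_cell L a (insert j I) (insert j J) \<noteq> {})
        * (-1) ^ dim (flat L a (insert j J)) * indicator (halfspace_cone L a (insert j J)) z)"
    unfolding tangent_sum_def Pow_insert using assms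
    by (subst sum.union_disjoint) (auto simp: sum.reindex[OF inj])
  also have "\<dots> = (\<Sum>J\<in>Pow I. (of_bool (open_cell L a I J \<inter> {x. 0 < a j \<bullet> x} \<noteq> {}) * (-1) ^ dim (flat L a J)
       + of_bool (open_cell L a I J \<inter> {x. a j \<bullet> x = 0} \<noteq> {})
         * (-1) ^ dim (flat L a J \<inter> {x. a j \<bullet> x = 0}) * of_bool (0 \<le> a j \<bullet> z))
       * indicator (halfspace_cone L a J) z)"
    unfolding sum.distrib[symmetric]
  proof (rule sum.cong[OF refl])
    fix J assume "J \<in> Pow I"
    then have "J \<subseteq> I" by simp
    note s = open_cell_insert[OF assms(2) this]
    show "of_bool (open_cell L a (insert j I) J \<noteq> {}) * (-1) ^ dim (flat L a J)
        * indicator (halfspace_cone L a J) z + of_bool (open_cell L a (insert j I) (insert j J) \<noteq> {})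
        * (-1) ^ dim (flat L a (insert j J)) * indicator (halfspace_cone L a (insert j J)) z
      = (of_bool (open_cell L a I J \<inter> {x. 0 < a j \<bullet> x} \<noteq> {}) * (-1) ^ dim (flat L a J)
       + of_bool (open_cell L a I J \<inter> {x. a j \<bullet> x = 0} \<noteq> {})
         * (-1) ^ dim (flat L a J \<inter> {x. a j \<bullet> x = 0}) * of_bool (0 \<le> a j \<bullet> z))
       * (indicator (halfspace_cone L a J) z :: int)"
      unfolding s(1,2) flat_insert(1) halfspace_cone_insert(1)
      by (auto simp: indicator_def algebra_simps)
  qed
  finally show ?thesis .
qed

lemma tangent_sum_kernel:
  assumes "j \<notin> I"
  shows "tangent_sum (L \<inter> {x. a j \<bullet> x = 0}) a I z =
    (\<Sum>J\<in>Pow I. of_bool (open_cell L a I J \<inter> {x. a j \<bullet> x = 0} \<noteq> {})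
         * (-1) ^ dim (flat L a J \<inter> {x. a j \<bullet> x = 0}) * of_bool (a j \<bullet> z = 0)
       * indicator (halfspace_cone L a J) z)"
  unfolding tangent_sum_def
proof (rule sum.cong[OF refl])
  fix J assume "J \<in> Pow I"
  then have "J \<subseteq> I" by simp
  note s = open_cell_insert[OF assms this]
  show "of_bool (open_cell (L \<inter> {x. a j \<bullet> x = 0}) a I J \<noteq> {})
     * (-1) ^ dim (flat (L \<inter> {x. a j \<bullet> x = 0}) a J) * indicator (halfspace_cone (L \<inter> {x. a j \<bullet> x = 0}) a J) z
    = of_bool (open_cell L a I J \<inter> {x. a j \<bullet> x = 0} \<noteq> {})
         * (-1) ^ dim (flat L a J \<inter> {x. a j \<bullet> x = 0}) * of_bool (a j \<bullet> z = 0)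
       * (indicator (halfspace_cone L a J) z :: int)"
    unfolding s(3) flat_insert(2) halfspace_cone_insert(2)
    by (auto simp: indicator_def)
qed

lemma open_cell_convex:
  assumes "subspace L" shows "convex (open_cell L a I J)"
proof -
  have "open_cell L a I J = flat L a J \<inter> (\<Inter>i\<in>I - J. {x. a i \<bullet> x > 0})"
    by (auto simp: open_cell_def)
  then show ?thesis
    by (simp add: convex_Int convex_INT convex_halfspace_gt subspace_imp_convex subspace_flat assms)
qed

text \<open>
The contribution of one cell to the valuation property.  A cell is relatively open in its flat, so
either \<open>b\<close> vanishes on the flat, or the cell meets the hyperplane exactly when it has points on both
sides; in the second case the hyperplane section has dimension one less, and its two copies with
opposite sign compensate for the cell being counted twice.
\<close>

lemma open_cell_cut:
  fixes L :: "'a::euclidean_space set"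
  assumes "finite I" "subspace L"
  shows "(of_bool (open_cell L a I J \<noteq> {}) * (-1) ^ dim (flat L a J) :: int)
      + of_bool (open_cell L a I J \<inter> {x. b \<bullet> x = 0} \<noteq> {})
          * (-1) ^ dim (flat L a J \<inter> {x. b \<bullet> x = 0}) * of_bool (b \<bullet> z = 0)
    = of_bool (open_cell L a I J \<inter> {x. 0 < b \<bullet> x} \<noteq> {}) * (-1) ^ dim (flat L a J)
      + of_bool (open_cell L a I J \<inter> {x. b \<bullet> x = 0} \<noteq> {})
          * (-1) ^ dim (flat L a J \<inter> {x. b \<bullet> x = 0}) * of_bool (0 \<le> b \<bullet> z)
      + (of_bool (open_cell L a I J \<inter> {x. b \<bullet> x < 0} \<noteq> {}) * (-1) ^ dim (flat L a J)
      + of_bool (open_cell L a I J \<inter> {x. b \<bullet> x = 0} \<noteq> {})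
          * (-1) ^ dim (flat L a J \<inter> {x. b \<bullet> x = 0}) * of_bool (b \<bullet> z \<le> 0))"
proof -
  define U W where "U = open_cell L a I J" and "W = flat L a J"
  define pos where "pos \<longleftrightarrow> (\<exists>u\<in>U. 0 < b \<bullet> u)"
  define nul where "nul \<longleftrightarrow> (\<exists>u\<in>U. b \<bullet> u = 0)"
  define neg where "neg \<longleftrightarrow> (\<exists>u\<in>U. b \<bullet> u < 0)"
  have meets: "U \<inter> {x. 0 < b \<bullet> x} \<noteq> {} \<longleftrightarrow> pos" "U \<inter> {x. b \<bullet> x = 0} \<noteq> {} \<longleftrightarrow> nul"
    "U \<inter> {x. b \<bullet> x < 0} \<noteq> {} \<longleftrightarrow> neg"
    unfolding pos_def nul_def neg_def by blast+
  have UW: "U \<subseteq> W" unfolding U_def W_def open_cell_def by blast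
  have W: "subspace W" unfolding W_def using assms(2) by (rule subspace_flat)
  have perturb: "\<exists>e>0. x + e *\<^sub>R w \<in> U \<and> x - e *\<^sub>R w \<in> U" if "x \<in> U" "w \<in> W" for x w
    using that unfolding U_def W_def by (rule open_cell_perturb[OF assms])
  have both: "pos \<and> neg" if nul and w: "w \<in> W" "b \<bullet> w \<noteq> 0" for w
  proof -
    obtain x where x: "x \<in> U" "b \<bullet> x = 0"
      using \<open>nul\<close> nul_def by blast
    then obtain e where e: "e > 0" "x + e *\<^sub>R w \<in> U" "x - e *\<^sub>R w \<in> U"
      using perturb w by blast
    have v: "b \<bullet> (x + e *\<^sub>R w) = e * (b \<bullet> w)" "b \<bullet> (x - e *\<^sub>R w) = - (e * (b \<bullet> w))"
      using x by (simp_all add: inner_add_right inner_diff_right)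
    show ?thesis
    proof (cases "0 < b \<bullet> w")
      case True
      then have "0 < b \<bullet> (x + e *\<^sub>R w)" "b \<bullet> (x - e *\<^sub>R w) < 0"
        unfolding v using e(1) by simp_all
      then show ?thesis using e(2,3) pos_def neg_def by blast
    next
      case False
      then have "0 < b \<bullet> (x - e *\<^sub>R w)" "b \<bullet> (x + e *\<^sub>R w) < 0"
        unfolding v using e(1) w(2) by (simp_all add: mult_less_0_iff)
      then show ?thesis using e(2,3) pos_def neg_def by blast
    qed
  qed
  have nul: nul if pn: pos neg
  proof -
    obtain x y where "x \<in> U" "0 < b \<bullet> x" "y \<in> U" "b \<bullet> y < 0"
      using pn unfolding pos_def neg_def by blast
    moreover have "connected U"
      unfolding U_def by (rule convex_connected[OF open_cell_convex[OF assms(2)]])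
    ultimately show nul
      unfolding nul_def by (intro connected_ivt_hyperplane[of U y x]) auto
  qed
  have sign: "of_bool (0 \<le> b \<bullet> z) = 1 + of_bool (b \<bullet> z = 0) - (of_bool (b \<bullet> z \<le> 0) :: int)"
    by simp
  show ?thesis
  proof (cases "\<exists>w\<in>W. b \<bullet> w \<noteq> 0")
    case True
    then have e: "(-1 :: int) ^ dim (W \<inter> {x. b \<bullet> x = 0}) = - ((-1) ^ dim W)"
      using neg_one_power_dim_kernel[OF W] by blast
    have "nul \<longleftrightarrow> pos \<and> neg"
      using True both nul by blast
    moreover have "U \<noteq> {} \<longleftrightarrow> pos \<or> nul \<or> neg"
      unfolding pos_def nul_def neg_def using linorder_less_linear by blast
    ultimately show ?thesis
      unfolding W_def[symmetric] U_def[symmetric] meets e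
      unfolding sign by (cases pos; cases neg) (simp_all only: of_bool_eq, simp_all add: algebra_simps)
  next
    case False
    then have "W \<inter> {x. b \<bullet> x = 0} = W" by blast
    moreover have zero: "b \<bullet> u = 0" if "u \<in> U" for u
      using False UW that by blast
    then have "\<not> pos" "\<not> neg" "nul \<longleftrightarrow> U \<noteq> {}"
      unfolding pos_def neg_def nul_def by auto
    ultimately show ?thesis
      unfolding W_def[symmetric] U_def[symmetric] meets sign by (simp add: algebra_simps)
  qed
qed

lemma tangent_sum_valuation:
  assumes "finite I" "subspace L" "j \<notin> I"
  shows "tangent_sum L a I z + tangent_sum (L \<inter> {x. a j \<bullet> x = 0}) a I z
    = tangent_sum L a (insert j I) z + tangent_sum L (a(j := - a j)) (insert j I) z"
proof -
  let ?a = "a(j := - a j)"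
  have cong: "open_cell L ?a I J = open_cell L a I J" "flat L ?a J = flat L a J"
    "halfspace_cone L ?a J = halfspace_cone L a J" if "J \<in> Pow I" for J
  proof -
    have "J \<subseteq> I" "?a i = a i" if "i \<in> I" for i
      using \<open>J \<in> Pow I\<close> assms(3) that by auto
    then show "open_cell L ?a I J = open_cell L a I J" "flat L ?a J = flat L a J"
      "halfspace_cone L ?a J = halfspace_cone L a J"
      using \<open>J \<in> Pow I\<close> halfspace_system_cong[of I ?a a J L] by blast+
  qed
  show ?thesis
    unfolding tangent_sum_insert[OF assms(1,3)] tangent_sum_kernel[OF assms(3)]
      tangent_sum_def[of L a I z] sum.distrib[symmetric]
  proof (rule sum.cong[OF refl])
    fix J assume J: "J \<in> Pow I"
    show "of_bool (open_cell L a I J \<noteq> {}) * (-1) ^ dim (flat L a J) * indicator (halfspace_cone L a J) z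
      + of_bool (open_cell L a I J \<inter> {x. a j \<bullet> x = 0} \<noteq> {})
         * (-1) ^ dim (flat L a J \<inter> {x. a j \<bullet> x = 0}) * of_bool (a j \<bullet> z = 0)
         * indicator (halfspace_cone L a J) z
      = (of_bool (open_cell L a I J \<inter> {x. 0 < a j \<bullet> x} \<noteq> {}) * (-1) ^ dim (flat L a J)
       + of_bool (open_cell L a I J \<inter> {x. a j \<bullet> x = 0} \<noteq> {})
         * (-1) ^ dim (flat L a J \<inter> {x. a j \<bullet> x = 0}) * of_bool (0 \<le> a j \<bullet> z))
         * indicator (halfspace_cone L a J) z
      + (of_bool (open_cell L ?a I J \<inter> {x. 0 < ?a j \<bullet> x} \<noteq> {}) * (-1) ^ dim (flat L ?a J)
       + of_bool (open_cell L ?a I J \<inter> {x. ?a j \<bullet> x = 0} \<noteq> {})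
         * (-1) ^ dim (flat L ?a J \<inter> {x. ?a j \<bullet> x = 0}) * of_bool (0 \<le> ?a j \<bullet> z))
         * (indicator (halfspace_cone L ?a J) z :: int)"
      unfolding cong[OF J] distrib_right[symmetric]
      using open_cell_cut[OF assms(1,2), of a J "a j" z] by simp
  qed
qed

section \<open>The signed interior as a valuation\<close>

text \<open>
The sign change of \<open>z\<close> matches the alternating sum over faces: if \<open>- z\<close> is relatively interior, then
only from relatively interior points of \<open>C\<close> can one move in direction \<open>z\<close> within \<open>C\<close>, so \<open>C\<close> itself
is the only face that is counted.
\<close>

definition signed_interior :: "'a::euclidean_space set \<Rightarrow> 'a \<Rightarrow> int" where
  "signed_interior C z = (-1) ^ dim C * indicator (rel_interior C) (- z)"

lemma rel_interior_meets_open: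
  fixes C :: "'a::euclidean_space set"
  assumes "convex C" "open T" "x \<in> C" "x \<in> T"
  shows "rel_interior C \<inter> T \<noteq> {}"
proof -
  have "x \<in> closure (rel_interior C)"
    using assms(1,3) closure_subset by (auto simp: convex_closure_rel_interior)
  then have "T \<inter> closure (rel_interior C) \<noteq> {}"
    using assms(4) by blast
  then show ?thesis
    using open_Int_closure_eq_empty[OF assms(2)] by blast
qed

lemma convex_cone_Int: "convex_cone S \<Longrightarrow> convex_cone T \<Longrightarrow> convex_cone (S \<inter> T)"
  by (simp add: convex_cone_iff)

lemma signed_interior_Int_halfspace:
  fixes C :: "'a::euclidean_space set"
  assumes C: "convex_cone C" and x: "x \<in> C" "0 < b \<bullet> x"
  shows "signed_interior (C \<inter> {x. 0 \<le> b \<bullet> x}) z = of_bool (b \<bullet> z < 0) * signed_interior C z"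
proof -
  have conv: "convex C" using C by (simp add: convex_cone_def)
  have "b \<noteq> 0" using x by auto
  then have int: "interior {x. 0 \<le> b \<bullet> x} = {x. 0 < b \<bullet> x}"
    using interior_halfspace_ge[of b 0] by simp
  then have "rel_interior {x. 0 \<le> b \<bullet> x} = {x. 0 < b \<bullet> x}"
    using x(2) rel_interior_nonempty_interior[of "{x. 0 \<le> b \<bullet> x}"] by blast
  moreover have "rel_interior C \<inter> {x. 0 < b \<bullet> x} \<noteq> {}"
    using x by (intro rel_interior_meets_open[OF conv]) (auto simp: open_halfspace_gt)
  ultimately have ri: "rel_interior (C \<inter> {x. 0 \<le> b \<bullet> x}) = rel_interior C \<inter> {x. 0 < b \<bullet> x}"
    using convex_rel_interior_inter_two[OF conv convex_halfspace_ge[of 0 b]] by simp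
  have "aff_dim (C \<inter> {x. 0 \<le> b \<bullet> x}) = aff_dim C"
    using x int by (intro aff_dim_convex_Int_nonempty_interior[OF conv]) auto
  then have "dim (C \<inter> {x. 0 \<le> b \<bullet> x}) = dim C"
    using C convex_cone_Int[OF C convex_cone_halfspace_ge[of b]] by (simp add: aff_dim_convex_cone)
  then show ?thesis
    by (auto simp: signed_interior_def ri indicator_def)
qed

text \<open>
The nontrivial inclusion uses that \<open>u\<close> is relatively interior: from \<open>u\<close> one can move a little in
any direction of the span, in particular inside the hyperplane, without leaving \<open>C\<close>.
\<close>

lemma span_Int_kernel:
  fixes C :: "'a::euclidean_space set"
  assumes C: "convex_cone C" and u: "u \<in> rel_interior C" "b \<bullet> u = 0"
  shows "span (C \<inter> {x. b \<bullet> x = 0}) = span C \<inter> {x. b \<bullet> x = 0}" (is "span ?C0 = _ \<inter> ?H")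
proof
  have "subspace (span C \<inter> ?H)"
    by (rule subspace_Int_kernel[OF subspace_span])
  then show "span ?C0 \<subseteq> span C \<inter> ?H"
    by (rule span_minimal[rotated]) (auto intro: span_base)
  show "span C \<inter> ?H \<subseteq> span ?C0"
  proof
    fix v assume v: "v \<in> span C \<inter> ?H"
    have conv: "convex C" using C by (simp add: convex_cone_def)
    have "affine hull C = span C"
      using convex_cone_contains_0[OF C] by (intro affine_hull_span_0) (simp add: hull_inc)
    then obtain e where e: "e > 1" "(1 - e) *\<^sub>R v + e *\<^sub>R u \<in> C"
      using convex_rel_interior_if2[OF conv u(1)] v by blast
    have "(1 - e) *\<^sub>R v + e *\<^sub>R u \<in> span ?C0" "u \<in> span ?C0"
      using e(2) u v rel_interior_subset by (auto intro!: span_base simp: inner_add_right)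
    then have "((1 - e) *\<^sub>R v + e *\<^sub>R u) - e *\<^sub>R u \<in> span ?C0"
      by (intro span_diff span_scale)
    then have "(1 - e) *\<^sub>R v \<in> span ?C0" by simp
    then show "v \<in> span ?C0"
      using e(1) span_scale[of "(1 - e) *\<^sub>R v" ?C0 "inverse (1 - e)"] by simp
  qed
qed

text \<open>
Points on both sides of the hyperplane force it to meet the relative interior; the section then has
dimension one less, and its relative interior is the section of the relative interior.
\<close>

lemma signed_interior_Int_kernel:
  fixes C :: "'a::euclidean_space set"
  assumes C: "convex_cone C" and x: "x \<in> C" "0 < b \<bullet> x" and y: "y \<in> C" "b \<bullet> y < 0"
  shows "signed_interior (C \<inter> {x. b \<bullet> x = 0}) z = - of_bool (b \<bullet> z = 0) * signed_interior C z"
proof -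
  have conv: "convex C" using C by (simp add: convex_cone_def)
  obtain p where p: "p \<in> rel_interior C" "0 < b \<bullet> p"
    using rel_interior_meets_open[OF conv open_halfspace_gt[of 0 b] x(1)] x(2) by auto
  obtain q where q: "q \<in> rel_interior C" "b \<bullet> q < 0"
    using rel_interior_meets_open[OF conv open_halfspace_lt[of b 0] y(1)] y(2) by auto
  have "connected (rel_interior C)"
    by (intro convex_connected convex_rel_interior conv)
  then obtain u where u: "u \<in> rel_interior C" "b \<bullet> u = 0"
    using connected_ivt_hyperplane[of "rel_interior C" q p b 0] p q by auto
  have ri: "rel_interior (C \<inter> {x. b \<bullet> x = 0}) = rel_interior C \<inter> {x. b \<bullet> x = 0}"
    using u by (intro convex_affine_rel_interior_Int[OF conv affine_hyperplane]) auto
  have "(-1 :: int) ^ dim (C \<inter> {x. b \<bullet> x = 0}) = (-1) ^ dim (span C \<inter> {x. b \<bullet> x = 0})"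
    using span_Int_kernel[OF C u] by (metis dim_span)
  also have "\<dots> = - ((-1) ^ dim C)"
    using neg_one_power_dim_kernel[OF subspace_span span_base[OF x(1)]] x(2) by simp
  finally show ?thesis
    by (auto simp: signed_interior_def ri indicator_def)
qed

text \<open>
If \<open>C\<close> lies on one side of the hyperplane, the two halves are \<open>C\<close> and the slice in some order.
Otherwise the relative interior splits into those of the two halves and of the slice, and the sign
of the slice is opposite to that of \<open>C\<close>.
\<close>

lemma signed_interior_valuation:
  fixes C :: "'a::euclidean_space set"
  assumes C: "convex_cone C"
  shows "signed_interior C z + signed_interior (C \<inter> {x. b \<bullet> x = 0}) z
    = signed_interior (C \<inter> {x. 0 \<le> b \<bullet> x}) z + signed_interior (C \<inter> {x. 0 \<le> - b \<bullet> x}) z"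
proof (cases "\<exists>x\<in>C. 0 < b \<bullet> x")
  case False
  then have "C \<inter> {x. 0 \<le> b \<bullet> x} = C \<inter> {x. b \<bullet> x = 0}" "C \<inter> {x. 0 \<le> - b \<bullet> x} = C"
    by force+
  then show ?thesis by (simp only: add.commute)
next
  case True
  then obtain x where x: "x \<in> C" "0 < b \<bullet> x" by blast
  show ?thesis
  proof (cases "\<exists>y\<in>C. b \<bullet> y < 0")
    case False
    then have "C \<inter> {x. 0 \<le> - b \<bullet> x} = C \<inter> {x. b \<bullet> x = 0}" "C \<inter> {x. 0 \<le> b \<bullet> x} = C"
      by force+
    then show ?thesis by (simp only:)
  next
    case True
    then obtain y where y: "y \<in> C" "b \<bullet> y < 0" by blast
    have "signed_interior (C \<inter> {x. 0 \<le> - b \<bullet> x}) z = of_bool (- b \<bullet> z < 0) * signed_interior C z"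
      using y by (intro signed_interior_Int_halfspace[OF C y(1)]) simp
    then show ?thesis
      unfolding signed_interior_Int_halfspace[OF C x] signed_interior_Int_kernel[OF C x y]
      by auto
  qed
qed

section \<open>The alternating sum equals the signed interior\<close>

text \<open>
A functional vanishing on the common kernel of finitely many functionals is a linear combination of
them.  Stated relative to a subspace \<open>L\<close>, it follows by restricting successively to the kernels.
\<close>

lemma linear_combination_of_functionals:
  fixes L :: "'a::euclidean_space set"
  assumes "finite K" "subspace L" "\<And>x. x \<in> L \<Longrightarrow> \<forall>i\<in>K. a i \<bullet> x = 0 \<Longrightarrow> b \<bullet> x = 0"
  shows "\<exists>c. \<forall>x\<in>L. b \<bullet> x = (\<Sum>i\<in>K. c i * (a i \<bullet> x))"
  using assms
proof (induction K arbitrary: L)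
  case empty
  then show ?case by simp
next
  case (insert k K)
  have sub: "subspace (L \<inter> {x. a k \<bullet> x = 0})"
    by (rule subspace_Int_kernel[OF insert.prems(1)])
  have "b \<bullet> x = 0" if "x \<in> L \<inter> {x. a k \<bullet> x = 0}" "\<forall>i\<in>K. a i \<bullet> x = 0" for x
    using insert.prems(2)[of x] that by simp
  from insert.IH[OF sub this] obtain c
    where "\<forall>x\<in>L \<inter> {x. a k \<bullet> x = 0}. b \<bullet> x = (\<Sum>i\<in>K. c i * (a i \<bullet> x))"
    by (rule exE)
  then have c: "b \<bullet> x = (\<Sum>i\<in>K. c i * (a i \<bullet> x))" if "x \<in> L" "a k \<bullet> x = 0" for x
    using that by simp
  show ?case
  proof (cases "\<exists>w\<in>L. a k \<bullet> w \<noteq> 0")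
    case False
    then have "\<forall>x\<in>L. b \<bullet> x = (\<Sum>i\<in>insert k K. c i * (a i \<bullet> x))"
      using c insert.hyps by simp
    then show ?thesis by blast
  next
    case True
    then obtain w where w: "w \<in> L" "a k \<bullet> w \<noteq> 0" by blast
    \<comment> \<open>The coefficient of \<open>a k\<close> is determined by requiring the identity at \<open>w\<close>.\<close>
    define s where "s = (b \<bullet> w - (\<Sum>i\<in>K. c i * (a i \<bullet> w))) / (a k \<bullet> w)"
    have "b \<bullet> x = (\<Sum>i\<in>insert k K. (c(k := s)) i * (a i \<bullet> x))" if x: "x \<in> L" for x
    proof -
      define t where "t = (a k \<bullet> x) / (a k \<bullet> w)"
      have "x - t *\<^sub>R w \<in> L"
        using x w(1) insert.prems(1) by (simp add: subspace_diff subspace_scale)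
      moreover have "a k \<bullet> (x - t *\<^sub>R w) = 0"
        using w(2) by (simp add: t_def inner_diff_right)
      ultimately have "b \<bullet> (x - t *\<^sub>R w) = (\<Sum>i\<in>K. c i * (a i \<bullet> (x - t *\<^sub>R w)))"
        by (rule c)
      also have "\<dots> = (\<Sum>i\<in>K. c i * (a i \<bullet> x)) - t * (\<Sum>i\<in>K. c i * (a i \<bullet> w))"
        by (simp add: inner_diff_right right_diff_distrib sum_subtractf sum_distrib_left mult.left_commute)
      finally have "b \<bullet> x = (\<Sum>i\<in>K. c i * (a i \<bullet> x)) + t * (b \<bullet> w - (\<Sum>i\<in>K. c i * (a i \<bullet> w)))"
        by (simp add: inner_diff_right algebra_simps)
      also have "t * (b \<bullet> w - (\<Sum>i\<in>K. c i * (a i \<bullet> w))) = s * (a k \<bullet> x)"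
        by (simp add: t_def s_def)
      also have "(\<Sum>i\<in>K. c i * (a i \<bullet> x)) = (\<Sum>i\<in>K. (c(k := s)) i * (a i \<bullet> x))"
        using insert.hyps by (intro sum.cong) auto
      finally show ?thesis
        using insert.hyps by simp
    qed
    then show ?thesis by blast
  qed
qed

text \<open>
Adding multiples of \<open>w\<close> moves the points of every cell of the system \<open>K\<close> across all levels of
\<open>a j\<close> without leaving the cell.  So each nonempty cell yields one cell off the hyperplane and one
cell of opposite sign on it; they cancel unless \<open>z\<close> is excluded from the tangent cone of the latter.
\<close>

lemma tangent_sum_insert_independent:
  assumes fin: "finite K" and L: "subspace L" and j: "j \<notin> K"
    and w: "w \<in> L" "a j \<bullet> w \<noteq> 0" "\<forall>i\<in>K. a i \<bullet> w = 0"
  shows "tangent_sum L a (insert j K) z = of_bool (a j \<bullet> z < 0) * tangent_sum L a K z"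
  unfolding tangent_sum_insert[OF fin j] tangent_sum_def[of L a K z] sum_distrib_left
proof (rule sum.cong[OF refl])
  fix J assume "J \<in> Pow K"
  then have JK: "J \<subseteq> K" by simp
  define U W where "U = open_cell L a K J" and "W = flat L a J"
  have "w \<in> W"
    using w JK by (auto simp: W_def flat_def)
  then have e: "(-1 :: int) ^ dim (W \<inter> {x. a j \<bullet> x = 0}) = - ((-1) ^ dim W)"
    using neg_one_power_dim_kernel[OF subspace_flat[OF L] _ w(2)] by (simp add: W_def)
  have level: "\<exists>v\<in>U. a j \<bullet> v = s" if u: "u \<in> U" for u s
  proof
    \<comment> \<open>The multiple of \<open>w\<close> that changes the value of \<open>a j\<close> from \<open>a j \<bullet> u\<close> to \<open>s\<close>.\<close>
    let ?v = "u + ((s - a j \<bullet> u) / (a j \<bullet> w)) *\<^sub>R w"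
    show "a j \<bullet> ?v = s"
      using w(2) by (simp add: inner_add_right)
    have "?v \<in> flat L a J"
      using u \<open>w \<in> W\<close> unfolding U_def W_def open_cell_def
      by (intro subspace_add subspace_scale subspace_flat[OF L]) auto
    then show "?v \<in> U"
      using u w(3) by (simp add: U_def open_cell_def inner_add_right)
  qed
  have pos: "U \<inter> {x. 0 < a j \<bullet> x} \<noteq> {} \<longleftrightarrow> U \<noteq> {}"
    using level[of _ 1] by (metis (mono_tags, lifting) disjoint_iff mem_Collect_eq zero_less_one all_not_in_conv)
  have nul: "U \<inter> {x. a j \<bullet> x = 0} \<noteq> {} \<longleftrightarrow> U \<noteq> {}"
    using level[of _ 0] by blast
  show "(of_bool (open_cell L a K J \<inter> {x. 0 < a j \<bullet> x} \<noteq> {}) * (-1) ^ dim (flat L a J)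
       + of_bool (open_cell L a K J \<inter> {x. a j \<bullet> x = 0} \<noteq> {})
         * (-1) ^ dim (flat L a J \<inter> {x. a j \<bullet> x = 0}) * of_bool (0 \<le> a j \<bullet> z))
       * indicator (halfspace_cone L a J) z
     = of_bool (a j \<bullet> z < 0) * (of_bool (open_cell L a K J \<noteq> {}) * (-1) ^ dim (flat L a J)
        * (indicator (halfspace_cone L a J) z :: int))"
    unfolding U_def[symmetric] W_def[symmetric] pos nul e by simp
qed

text \<open>
Where the inequalities in \<open>K\<close> hold, \<open>a j\<close> is nonpositive, so no cell has points on its positive
side.  If a cell meets the hyperplane, all inactive inequalities have coefficient zero, so \<open>a j\<close> is
a nonpositive combination of the active ones and \<open>0 \<le> a j \<bullet> z\<close> on the tangent cone amounts to
\<open>a j \<bullet> z = 0\<close>.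
\<close>

lemma tangent_sum_insert_redundant:
  assumes fin: "finite K" and j: "j \<notin> K"
    and c: "\<And>x. x \<in> L \<Longrightarrow> a j \<bullet> x = (\<Sum>i\<in>K. c i * (a i \<bullet> x))" "\<And>i. i \<in> K \<Longrightarrow> c i \<le> 0"
  shows "tangent_sum L a (insert j K) z = tangent_sum (L \<inter> {x. a j \<bullet> x = 0}) a K z"
  unfolding tangent_sum_insert[OF fin j] tangent_sum_kernel[OF j]
proof (rule sum.cong[OF refl])
  fix J assume "J \<in> Pow K"
  then have JK: "J \<subseteq> K" by simp
  have cell: "u \<in> L" "\<forall>i\<in>K. 0 \<le> a i \<bullet> u" "\<forall>i\<in>K - J. 0 < a i \<bullet> u" if "u \<in> open_cell L a K J" for u
  proof -
    have u: "u \<in> L" "\<forall>i\<in>J. a i \<bullet> u = 0" and pos: "\<forall>i\<in>K - J. 0 < a i \<bullet> u"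
      using that by (simp_all add: open_cell_def flat_def)
    have "0 \<le> a i \<bullet> u" if "i \<in> K" for i
      using u(2) pos that by (cases "i \<in> J") (simp_all add: less_imp_le)
    then show "u \<in> L" "\<forall>i\<in>K. 0 \<le> a i \<bullet> u" "\<forall>i\<in>K - J. 0 < a i \<bullet> u"
      using u(1) pos by blast+
  qed
  have "a j \<bullet> u \<le> 0" if "u \<in> open_cell L a K J" for u
    using cell[OF that] c by (simp add: sum_nonpos mult_nonpos_nonneg)
  then have pos: "open_cell L a K J \<inter> {x. 0 < a j \<bullet> x} = {}"
    by force
  have "a j \<bullet> z = 0" if u: "u \<in> open_cell L a K J" "a j \<bullet> u = 0"
    and z: "z \<in> halfspace_cone L a J" "0 \<le> a j \<bullet> z" for u
  proof -
    have "(\<Sum>i\<in>K. c i * (a i \<bullet> u)) = 0"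
      using c(1)[of u] cell(1)[OF u(1)] u(2) by simp
    moreover have "\<forall>i\<in>K. c i * (a i \<bullet> u) \<le> 0"
      using cell(2)[OF u(1)] c(2) by (simp add: mult_nonpos_nonneg)
    ultimately have "\<forall>i\<in>K. c i * (a i \<bullet> u) = 0"
      using fin sum_nonneg_eq_0_iff[of K "\<lambda>i. - (c i * (a i \<bullet> u))"] by (simp add: sum_negf)
    then have c0: "c i = 0" if "i \<in> K - J" for i
      using cell(3)[OF u(1)] that by force
    have "c i * (a i \<bullet> z) \<le> 0" if "i \<in> K" for i
      using c0[of i] c(2)[of i] z(1) that
      by (cases "i \<in> J") (auto simp: halfspace_cone_def mult_nonpos_nonneg)
    then have "a j \<bullet> z \<le> 0"
      using c(1)[of z] z(1) by (simp add: halfspace_cone_def sum_nonpos)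
    then show ?thesis using z(2) by simp
  qed
  then have "open_cell L a K J \<inter> {x. a j \<bullet> x = 0} \<noteq> {} \<Longrightarrow> z \<in> halfspace_cone L a J
      \<Longrightarrow> 0 \<le> a j \<bullet> z \<longleftrightarrow> a j \<bullet> z = 0"
    by force
  then show "(of_bool (open_cell L a K J \<inter> {x. 0 < a j \<bullet> x} \<noteq> {}) * (-1) ^ dim (flat L a J)
       + of_bool (open_cell L a K J \<inter> {x. a j \<bullet> x = 0} \<noteq> {})
         * (-1) ^ dim (flat L a J \<inter> {x. a j \<bullet> x = 0}) * of_bool (0 \<le> a j \<bullet> z))
       * indicator (halfspace_cone L a J) z
     = of_bool (open_cell L a K J \<inter> {x. a j \<bullet> x = 0} \<noteq> {})
         * (-1) ^ dim (flat L a J \<inter> {x. a j \<bullet> x = 0}) * of_bool (a j \<bullet> z = 0)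
       * (indicator (halfspace_cone L a J) z :: int)"
    unfolding pos by (auto simp: indicator_def)
qed

text \<open>
The two systems describe the halves into which the hyperplane of \<open>a j\<close> cuts the cone of the system
\<open>I - {j}\<close>.  Both quantities are valuations and they agree on the uncut cone and on the slice, so
the discrepancies on the two halves are opposite.
\<close>

lemma tangent_sum_flip:
  assumes I: "finite I" "subspace L" "j \<in> I"
    and IH: "\<And>L a. subspace L \<Longrightarrow> tangent_sum L a (I - {j}) z = signed_interior (halfspace_cone L a (I - {j})) z"
  shows "tangent_sum L a I z = signed_interior (halfspace_cone L a I) z
    \<longleftrightarrow> tangent_sum L (a(j := - a j)) I z = signed_interior (halfspace_cone L (a(j := - a j)) I) z"
proof -
  define K where "K = I - {j}"
  let ?a = "a(j := - a j)"
  have K: "finite K" "j \<notin> K" and IK: "I = insert j K"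
    using I by (auto simp: K_def)
  let ?C = "halfspace_cone L a K"
  have flip: "halfspace_cone L ?a I = ?C \<inter> {x. 0 \<le> - a j \<bullet> x}"
    unfolding IK halfspace_cone_insert using K(2) by (auto simp: halfspace_cone_def)
  have "signed_interior ?C z + signed_interior (?C \<inter> {x. a j \<bullet> x = 0}) z
      = signed_interior (halfspace_cone L a I) z + signed_interior (halfspace_cone L ?a I) z"
    unfolding flip unfolding IK halfspace_cone_insert
    by (rule signed_interior_valuation[OF convex_cone_halfspace_cone[OF I(2)]])
  moreover have "tangent_sum L a K z + tangent_sum (L \<inter> {x. a j \<bullet> x = 0}) a K z
      = tangent_sum L a I z + tangent_sum L ?a I z"
    unfolding IK by (rule tangent_sum_valuation[OF K(1) I(2) K(2)])
  moreover have "tangent_sum L a K z = signed_interior ?C z"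
    "tangent_sum (L \<inter> {x. a j \<bullet> x = 0}) a K z = signed_interior (?C \<inter> {x. a j \<bullet> x = 0}) z"
    using IH[OF I(2)] IH[OF subspace_Int_kernel[OF I(2)]]
    by (simp_all add: K_def halfspace_cone_insert)
  ultimately show ?thesis by linarith
qed

text \<open>
The Euler relation for systems of inequalities.  The induction is over all vectors \<open>a\<close> and all
subspaces \<open>L\<close> at once, because slices live in smaller subspaces and signs are changed on the way.
\<close>

theorem tangent_sum_eq_signed_interior:
  assumes "finite I" "subspace L"
  shows "tangent_sum L a I z = signed_interior (halfspace_cone L a I) z"
  using assms
proof (induction I arbitrary: L a rule: finite_psubset_induct)
  case (psubset I L a)
  note L = \<open>subspace L\<close> and fin = \<open>finite I\<close>
  show ?case
  proof (cases "I = {}")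
    case True
    have "rel_interior L = L"
      using L by (simp add: rel_interior_affine subspace_imp_affine)
    moreover have "- z \<in> L \<longleftrightarrow> z \<in> L"
      using subspace_neg[OF L] by (metis minus_minus)
    moreover have "L \<noteq> {}"
      using subspace_0[OF L] by blast
    ultimately show ?thesis
      using True by (simp add: tangent_sum_def signed_interior_def halfspace_cone_def
          open_cell_def flat_def indicator_def)
  next
    case False
    then obtain j where "j \<in> I" by blast
    define K where "K = I - {j}"
    have K: "finite K" "j \<notin> K" "K \<subset> I" and IK: "I = insert j K"
      using fin \<open>j \<in> I\<close> by (auto simp: K_def)
    show ?thesis
    proof (cases "\<exists>w\<in>L. a j \<bullet> w \<noteq> 0 \<and> (\<forall>i\<in>K. a i \<bullet> w = 0)")
      case True
      then obtain w where w: "w \<in> L" "a j \<bullet> w \<noteq> 0" "\<forall>i\<in>K. a i \<bullet> w = 0" by blast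
      \<comment> \<open>Since \<open>w\<close> and \<open>- w\<close> both satisfy the system \<open>K\<close>, one of them is strictly inside the half-space of \<open>a j\<close>.\<close>
      define v where "v = (if 0 < a j \<bullet> w then w else - w)"
      have "v \<in> halfspace_cone L a K" "0 < a j \<bullet> v"
        using w subspace_neg[OF L] by (auto simp: v_def halfspace_cone_def)
      note signed_interior_Int_halfspace[OF convex_cone_halfspace_cone[OF L] this]
      then show ?thesis
        unfolding IK tangent_sum_insert_independent[where w = w, OF K(1) L K(2) w]
        by (simp add: halfspace_cone_insert psubset.IH[OF K(3) L])
    next
      case False
      then have "\<And>x. x \<in> L \<Longrightarrow> \<forall>i\<in>K. a i \<bullet> x = 0 \<Longrightarrow> a j \<bullet> x = 0" by blast
      from linear_combination_of_functionals[OF K(1) L this]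
      obtain c where c: "\<And>x. x \<in> L \<Longrightarrow> a j \<bullet> x = (\<Sum>i\<in>K. c i * (a i \<bullet> x))" by blast
      let ?flip = "\<lambda>N i. if i \<in> N then - a i else a i"
      let ?P = "\<lambda>a. tangent_sum L a I z = signed_interior (halfspace_cone L a I) z"
      have flips: "?P a \<longleftrightarrow> ?P (?flip N)" if "finite N" "N \<subseteq> I" for N
        using that
      proof (induction N)
        case empty
        show ?case by simp
      next
        case (insert i N)
        have "(?flip N)(i := - ?flip N i) = ?flip (insert i N)"
          using insert.hyps(2) by auto
        moreover have "?P (?flip N) \<longleftrightarrow> ?P ((?flip N)(i := - ?flip N i))"
          using insert.prems psubset.IH[of "I - {i}"] by (intro tangent_sum_flip[OF fin L]) auto
        ultimately show ?case
          using insert.IH insert.prems by simp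
      qed
      \<comment> \<open>Reversing the vectors with positive coefficient turns the coefficients \<open>c i\<close> into \<open>- \<bar>c i\<bar>\<close>.\<close>
      define N where "N = {i \<in> K. 0 < c i}"
      define a' where "a' = ?flip N"
      have "N \<subseteq> I" "finite N" "a' j = a j"
        using K by (auto simp: N_def a'_def)
      have "a' j \<bullet> x = (\<Sum>i\<in>K. - \<bar>c i\<bar> * (a' i \<bullet> x))" if "x \<in> L" for x
        unfolding \<open>a' j = a j\<close> c[OF that] by (intro sum.cong refl) (auto simp: a'_def N_def)
      note c' = this
      have "tangent_sum L a' I z = signed_interior (halfspace_cone L a' K \<inter> {x. a' j \<bullet> x = 0}) z"
      proof -
        have "tangent_sum L a' I z = tangent_sum (L \<inter> {x. a' j \<bullet> x = 0}) a' K z"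
          unfolding IK by (rule tangent_sum_insert_redundant[OF K(1,2) c']) auto
        also have "\<dots> = signed_interior (halfspace_cone L a' K \<inter> {x. a' j \<bullet> x = 0}) z"
          unfolding halfspace_cone_insert(2)[symmetric]
          by (rule psubset.IH[OF K(3) subspace_Int_kernel[OF L]])
        finally show ?thesis .
      qed
      also have "halfspace_cone L a' K \<inter> {x. a' j \<bullet> x = 0} = halfspace_cone L a' I"
      proof -
        have "a' j \<bullet> x \<le> 0" if "x \<in> halfspace_cone L a' K" for x
          using that c'[of x] by (auto simp: halfspace_cone_def intro!: sum_nonpos)
        then show ?thesis
          unfolding IK halfspace_cone_insert by force
      qed
      finally have "?P (?flip N)" by (simp add: a'_def)
      then show ?thesis
        using flips[OF \<open>finite N\<close> \<open>N \<subseteq> I\<close>] by blast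
    qed
  qed
qed

section \<open>Polyhedral cones by inequalities\<close>

lemma polyhedral_cone_eq_convex_cone_hull:
  assumes "finite S"
  shows "{(\<Sum>v\<in>S. c v *\<^sub>R v) |c. \<forall>v\<in>S. 0 \<le> c v} = convex_cone hull S" (is "?P = _")
proof
  show "?P \<subseteq> convex_cone hull S"
  proof
    fix x assume "x \<in> ?P"
    then obtain c where c: "x = (\<Sum>v\<in>S. c v *\<^sub>R v)" "\<forall>v\<in>S. 0 \<le> c v" by blast
    have "(\<Sum>v\<in>T. c v *\<^sub>R v) \<in> convex_cone hull S" if "T \<subseteq> S" for T
      using finite_subset[OF that assms] that
    proof (induction T rule: finite_induct)
      case empty
      then show ?case by (simp add: convex_cone_hull_contains_0)
    next
      case (insert v T)
      then show ?case
        using c(2) by (simp add: convex_cone_hull_add convex_cone_hull_mul hull_inc)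
    qed
    then show "x \<in> convex_cone hull S" using c(1) by blast
  qed
  have "convex_cone ?P"
    unfolding convex_cone_iff
  proof (intro conjI ballI allI impI)
    show "0 \<in> ?P" by (auto intro!: exI[of _ "\<lambda>_. 0"])
  next
    fix x y assume "x \<in> ?P" "y \<in> ?P"
    then obtain c d where "x = (\<Sum>v\<in>S. c v *\<^sub>R v)" "\<forall>v\<in>S. 0 \<le> c v"
      "y = (\<Sum>v\<in>S. d v *\<^sub>R v)" "\<forall>v\<in>S. 0 \<le> d v" by blast
    then show "x + y \<in> ?P"
      by (auto intro!: exI[of _ "\<lambda>v. c v + d v"] simp: scaleR_add_left sum.distrib)
  next
    fix x and t :: real assume "x \<in> ?P" "0 \<le> t"
    then obtain c where "x = (\<Sum>v\<in>S. c v *\<^sub>R v)" "\<forall>v\<in>S. 0 \<le> c v" by blast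
    then show "t *\<^sub>R x \<in> ?P"
      using \<open>0 \<le> t\<close> by (auto intro!: exI[of _ "\<lambda>v. t * c v"] simp: scaleR_sum_right)
  qed
  moreover have "S \<subseteq> ?P"
  proof
    fix w assume "w \<in> S"
    then have "w = (\<Sum>v\<in>S. of_bool (v = w) *\<^sub>R v)"
      using assms by (simp add: of_bool_def if_distrib[of "\<lambda>t. t *\<^sub>R _"] cong: if_cong)
    then show "w \<in> ?P" by (auto intro!: exI[of _ "\<lambda>v. of_bool (v = w)"])
  qed
  ultimately show "convex_cone hull S \<subseteq> ?P"
    by (rule hull_minimal[rotated])
qed

text \<open>
A finitely generated cone is an intersection of finitely many affine half-spaces.  Scaling
points of the cone shows that a functional bounded above on it is nonpositive on it, so the
constant terms can be replaced by \<open>0\<close>.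
\<close>

lemma polyhedral_cone_halfspaces:
  fixes C :: "'a::euclidean_space set"
  assumes "polyhedral_cone C"
  obtains A where "finite A" "C = halfspace_cone UNIV (\<lambda>v. v) A"
proof -
  obtain S where "finite S" "C = {(\<Sum>v\<in>S. c v *\<^sub>R v) |c. \<forall>v\<in>S. 0 \<le> c v}"
    using assms unfolding polyhedral_cone_def by (elim exE conjE)
  then have S: "finite S" "C = convex_cone hull S"
    by (simp_all only: polyhedral_cone_eq_convex_cone_hull)
  then have C: "convex_cone C" by (simp add: convex_cone_convex_cone_hull)
  obtain F where F: "finite F" "C = \<Inter> F" "\<forall>h\<in>F. \<exists>a b. a \<noteq> 0 \<and> h = {x. a \<bullet> x \<le> b}"
    using polyhedron_convex_cone_hull[OF S(1)] unfolding polyhedron_def S(2)[symmetric]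
    by (elim exE conjE)
  have "\<exists>p. \<forall>x. x \<in> h \<longleftrightarrow> fst p \<bullet> x \<le> snd p" if h: "h \<in> F" for h
  proof -
    obtain a b where "h = {x. a \<bullet> x \<le> b}"
      using bspec[OF F(3) h] by (elim exE conjE)
    then show ?thesis by (intro exI[of _ "(a, b)"]) simp
  qed
  then obtain p where p: "x \<in> h \<longleftrightarrow> fst (p h) \<bullet> x \<le> snd (p h)" if "h \<in> F" for h x
    by metis
  define a b where "a = (\<lambda>h. fst (p h))" and "b = (\<lambda>h. snd (p h))"
  have ab: "x \<in> h \<longleftrightarrow> a h \<bullet> x \<le> b h" if "h \<in> F" for h x
    using p[OF that] by (simp add: a_def b_def)
  have b: "0 \<le> b h" if "h \<in> F" for h
    using convex_cone_contains_0[OF C] F(2) ab[OF that, of 0] that by simp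
  have a: "a h \<bullet> x \<le> 0" if h: "h \<in> F" and x: "x \<in> C" for h x
  proof (rule ccontr)
    assume "\<not> a h \<bullet> x \<le> 0"
    then have pos: "0 < a h \<bullet> x" by simp
    then have "((b h + 1) / (a h \<bullet> x)) *\<^sub>R x \<in> C"
      using b[OF h] by (intro convex_cone_scaleR[OF C _ x]) simp
    then have "a h \<bullet> (((b h + 1) / (a h \<bullet> x)) *\<^sub>R x) \<le> b h"
      using F(2) ab[OF h] h by blast
    then show False using pos by simp
  qed
  have "C = halfspace_cone UNIV (\<lambda>v. v) ((\<lambda>h. - a h) ` F)"
  proof
    show "C \<subseteq> halfspace_cone UNIV (\<lambda>v. v) ((\<lambda>h. - a h) ` F)"
      using a by (auto simp: halfspace_cone_def)
    show "halfspace_cone UNIV (\<lambda>v. v) ((\<lambda>h. - a h) ` F) \<subseteq> C"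
    proof
      fix x assume "x \<in> halfspace_cone UNIV (\<lambda>v. v) ((\<lambda>h. - a h) ` F)"
      then have "a h \<bullet> x \<le> b h" if "h \<in> F" for h
        using b[OF that] that by (force simp: halfspace_cone_def)
      then show "x \<in> C"
        using F(2) ab by blast
    qed
  qed
  then show ?thesis
    using F(1) by (intro that) auto
qed

section \<open>Faces as closures of cells\<close>

definition active_face :: "'a::euclidean_space set \<Rightarrow> ('i \<Rightarrow> 'a) \<Rightarrow> 'i set \<Rightarrow> 'i set \<Rightarrow> 'a set" where
  "active_face L a I J = halfspace_cone L a I \<inter> flat L a J"

text \<open>
On the cone every summand of \<open>(\<Sum>i\<in>J. a i) \<bullet> x\<close> is nonnegative, so this single functional supports
the cone exactly along the points where all inequalities in \<open>J\<close> are active.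
\<close>

lemma active_face_face_of:
  assumes "finite I" "subspace L" "J \<subseteq> I"
  shows "active_face L a I J face_of halfspace_cone L a I"
proof -
  let ?C = "halfspace_cone L a I"
  have fin: "finite J" using assms finite_subset by blast
  have nonneg: "\<forall>i\<in>J. 0 \<le> a i \<bullet> x" if "x \<in> ?C" for x
    using that assms(3) by (auto simp: halfspace_cone_def)
  have "active_face L a I J = ?C \<inter> {x. (\<Sum>i\<in>J. a i) \<bullet> x = 0}"
  proof (rule set_eqI)
    fix x
    have "(\<Sum>i\<in>J. a i) \<bullet> x = 0 \<longleftrightarrow> (\<forall>i\<in>J. a i \<bullet> x = 0)" if "x \<in> ?C"
      using nonneg[OF that] fin by (simp add: inner_sum_left sum_nonneg_eq_0_iff)
    moreover have "x \<in> L" if "x \<in> ?C"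
      using that by (simp add: halfspace_cone_def)
    ultimately show "x \<in> active_face L a I J \<longleftrightarrow> x \<in> ?C \<inter> {x. (\<Sum>i\<in>J. a i) \<bullet> x = 0}"
      by (auto simp: active_face_def flat_def)
  qed
  moreover have "convex ?C"
    using convex_cone_halfspace_cone[OF assms(2)] unfolding convex_cone_def by blast
  moreover have "0 \<le> (\<Sum>i\<in>J. a i) \<bullet> x" if "x \<in> ?C" for x
    using nonneg[OF that] by (simp add: inner_sum_left sum_nonneg)
  ultimately show ?thesis
    using face_of_Int_supporting_hyperplane_ge[of ?C 0 "\<Sum>i\<in>J. a i"] by simp
qed

lemma open_cell_subset_active_face: "open_cell L a I J \<subseteq> active_face L a I J"
proof
  fix x assume x: "x \<in> open_cell L a I J"
  have "0 \<le> a i \<bullet> x" if "i \<in> I" for i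
    using x that by (cases "i \<in> J") (auto simp: open_cell_def flat_def less_imp_le)
  then show "x \<in> active_face L a I J"
    using x by (auto simp: active_face_def halfspace_cone_def open_cell_def flat_def)
qed

lemma open_cell_subset_rel_interior:
  assumes "finite I" "subspace L" "J \<subseteq> I"
  shows "open_cell L a I J \<subseteq> rel_interior (active_face L a I J)" (is "_ \<subseteq> rel_interior ?F")
proof
  fix x assume x: "x \<in> open_cell L a I J"
  then have ne: "x \<in> ?F" using open_cell_subset_active_face by blast
  have conv: "convex ?F"
    using active_face_face_of[OF assms] by (rule face_of_imp_convex)
  have "\<exists>e>1. (1 - e) *\<^sub>R y + e *\<^sub>R x \<in> ?F" if y: "y \<in> ?F" for y
  proof -
    have "x - y \<in> flat L a J"
      using ne y by (intro subspace_diff subspace_flat[OF assms(2)]) (auto simp: active_face_def)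
    then obtain e where e: "0 < e" "x + e *\<^sub>R (x - y) \<in> open_cell L a I J"
      using open_cell_perturb[OF assms(1,2) x] by blast
    have "(1 - (1 + e)) *\<^sub>R y + (1 + e) *\<^sub>R x = x + e *\<^sub>R (x - y)"
      by (simp add: algebra_simps)
    moreover have "x + e *\<^sub>R (x - y) \<in> ?F"
      using e(2) open_cell_subset_active_face by blast
    ultimately show ?thesis
      using e(1) by (intro exI[of _ "1 + e"]) simp
  qed
  then show "x \<in> rel_interior ?F"
    using convex_rel_interior_iff[OF conv] ne by blast
qed

lemma span_active_face:
  assumes "finite I" "subspace L" "open_cell L a I J \<noteq> {}"
  shows "span (active_face L a I J) = flat L a J"
proof
  show "span (active_face L a I J) \<subseteq> flat L a J"
    by (rule span_minimal) (auto simp: active_face_def subspace_flat[OF assms(2)])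
  obtain x where x: "x \<in> open_cell L a I J" using assms(3) by blast
  show "flat L a J \<subseteq> span (active_face L a I J)"
  proof
    fix w assume "w \<in> flat L a J"
    then obtain e where e: "0 < e" "x + e *\<^sub>R w \<in> open_cell L a I J"
      using open_cell_perturb[OF assms(1,2) x] by blast
    have "x \<in> span (active_face L a I J)" "x + e *\<^sub>R w \<in> span (active_face L a I J)"
      using x e(2) open_cell_subset_active_face by (blast intro: span_base)+
    then have "inverse e *\<^sub>R ((x + e *\<^sub>R w) - x) \<in> span (active_face L a I J)"
      by (intro span_scale span_diff)
    then show "w \<in> span (active_face L a I J)" using e(1) by simp
  qed
qed

text \<open>
Starting at a point \<open>x\<close> of the cell, a short step in a direction \<open>z\<close> respecting the active
inequalities stays in the cone; so \<open>z\<close> is a multiple of a point of the cone minus a multiple of \<open>x\<close>.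
\<close>

lemma tangent_cone_active_face:
  assumes "finite I" "subspace L" "J \<subseteq> I" "open_cell L a I J \<noteq> {}"
  shows "halfspace_cone L a I + span (active_face L a I J) = halfspace_cone L a J"
  unfolding span_active_face[OF assms(1,2,4)]
proof
  show "halfspace_cone L a I + flat L a J \<subseteq> halfspace_cone L a J"
    using assms(3) subspace_add[OF assms(2)]
    by (auto simp: halfspace_cone_def flat_def set_plus_def inner_add_right)
  show "halfspace_cone L a J \<subseteq> halfspace_cone L a I + flat L a J"
  proof
    fix z assume z: "z \<in> halfspace_cone L a J"
    obtain x where x: "x \<in> open_cell L a I J" using assms(4) by blast
    have fin: "finite (I - J)" using assms(1) by simp
    have pos: "\<forall>i\<in>I - J. 0 < a i \<bullet> x" using x by (simp add: open_cell_def)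
    obtain e where e: "0 < e" "\<forall>i\<in>I - J. 0 < a i \<bullet> (x + e *\<^sub>R z)"
      using perturb_positive[OF fin pos] by blast
    have xf: "x \<in> flat L a J" using x by (simp add: open_cell_def)
    have "0 \<le> a i \<bullet> (x + e *\<^sub>R z)" if "i \<in> I" for i
    proof (cases "i \<in> J")
      case True
      then show ?thesis using e(1) xf z by (simp add: inner_add_right flat_def halfspace_cone_def)
    next
      case False
      then show ?thesis using e(2) that by (simp add: less_imp_le)
    qed
    moreover have "x + e *\<^sub>R z \<in> L"
      using xf z by (intro subspace_add subspace_scale assms(2)) (auto simp: flat_def halfspace_cone_def)
    ultimately have "x + e *\<^sub>R z \<in> halfspace_cone L a I"
      by (simp add: halfspace_cone_def)
    then have "inverse e *\<^sub>R (x + e *\<^sub>R z) \<in> halfspace_cone L a I"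
      using e(1) by (intro convex_cone_scaleR[OF convex_cone_halfspace_cone[OF assms(2)]]) auto
    moreover have "- inverse e *\<^sub>R x \<in> flat L a J"
      by (rule subspace_scale[OF subspace_flat[OF assms(2)] xf])
    moreover have "z = inverse e *\<^sub>R (x + e *\<^sub>R z) + (- inverse e *\<^sub>R x)"
      using e(1) by (simp add: algebra_simps)
    ultimately show "z \<in> halfspace_cone L a I + flat L a J"
      by (metis set_plus_intro)
  qed
qed

lemma mem_open_cell_active:
  "x \<in> halfspace_cone L a I \<Longrightarrow> x \<in> open_cell L a I {i \<in> I. a i \<bullet> x = 0}"
  by (force simp: halfspace_cone_def open_cell_def flat_def)

text \<open>
The active set of a face is recovered from any point of its cell.  Conversely, the active set of a
relative interior point of a face gives a face with a relative interior point in common, and such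
faces coincide.
\<close>

lemma bij_betw_active_face:
  assumes "finite I" "subspace L"
  shows "bij_betw (active_face L a I) {J \<in> Pow I. open_cell L a I J \<noteq> {}}
    (cone_faces (halfspace_cone L a I))"
  unfolding bij_betw_def
proof
  let ?C = "halfspace_cone L a I"
  have sub: "J' \<subseteq> J"
    if J: "J' \<subseteq> I" "open_cell L a I J \<noteq> {}" and eq: "active_face L a I J = active_face L a I J'" for J J'
  proof
    fix i assume i: "i \<in> J'"
    obtain x where x: "x \<in> open_cell L a I J" using J(2) by blast
    then have "x \<in> active_face L a I J'"
      using open_cell_subset_active_face eq by blast
    then have "a i \<bullet> x = 0" using i by (simp add: active_face_def flat_def)
    then show "i \<in> J"
      using x i J(1) by (force simp: open_cell_def)
  qed
  show "inj_on (active_face L a I) {J \<in> Pow I. open_cell L a I J \<noteq> {}}"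
    by (rule inj_onI) (use sub in \<open>simp add: subset_antisym\<close>)
  show "active_face L a I ` {J \<in> Pow I. open_cell L a I J \<noteq> {}} = cone_faces ?C"
  proof (intro equalityI subsetI)
    fix F assume "F \<in> active_face L a I ` {J \<in> Pow I. open_cell L a I J \<noteq> {}}"
    then show "F \<in> cone_faces ?C"
      using active_face_face_of[OF assms] open_cell_subset_active_face
      by (fastforce simp: cone_faces_def)
  next
    fix F assume F: "F \<in> cone_faces ?C"
    then have face: "F face_of ?C" and ne: "F \<noteq> {}" by (auto simp: cone_faces_def)
    then obtain x where x: "x \<in> rel_interior F"
      using rel_interior_eq_empty[OF face_of_imp_convex] by blast
    then have "x \<in> ?C"
      using rel_interior_subset face_of_imp_subset[OF face] by blast
    define J where "J = {i \<in> I. a i \<bullet> x = 0}"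
    have J: "J \<subseteq> I" and cell: "x \<in> open_cell L a I J"
      using mem_open_cell_active[OF \<open>x \<in> ?C\<close>] by (auto simp: J_def)
    have "F = active_face L a I J"
      using x cell open_cell_subset_rel_interior[OF assms J]
      by (intro face_of_eq[OF face active_face_face_of[OF assms J]]) blast
    then show "F \<in> active_face L a I ` {J \<in> Pow I. open_cell L a I J \<noteq> {}}"
      using J cell by blast
  qed
qed

lemma tangent_sum_eq_sum_faces:
  fixes L :: "'a::euclidean_space set" and a :: "'i \<Rightarrow> 'a"
  assumes "finite I" "subspace L"
  defines "C \<equiv> halfspace_cone L a I"
  shows "tangent_sum L a I z = (\<Sum>F\<in>cone_faces C. (-1) ^ dim F * indicator (C + span F) z)"
proof -
  let ?\<J> = "{J \<in> Pow I. open_cell L a I J \<noteq> {}}"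
  have "(\<Sum>F\<in>cone_faces C. (-1) ^ dim F * indicator (C + span F) z)
      = (\<Sum>J\<in>?\<J>. (-1) ^ dim (active_face L a I J)
          * (indicator (C + span (active_face L a I J)) z :: int))"
    unfolding C_def by (rule sum.reindex_bij_betw[OF bij_betw_active_face[OF assms(1,2)], symmetric])
  also have "\<dots> = (\<Sum>J\<in>?\<J>. (-1) ^ dim (flat L a J) * indicator (halfspace_cone L a J) z)"
  proof (rule sum.cong[OF refl])
    fix J assume "J \<in> ?\<J>"
    then have J: "J \<subseteq> I" "open_cell L a I J \<noteq> {}" by auto
    have "dim (active_face L a I J) = dim (flat L a J)"
      using span_active_face[OF assms(1,2) J(2)] by (metis dim_span)
    then show "(-1) ^ dim (active_face L a I J) * (indicator (C + span (active_face L a I J)) z :: int)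
        = (-1) ^ dim (flat L a J) * indicator (halfspace_cone L a J) z"
      unfolding C_def tangent_cone_active_face[OF assms(1,2) J] by simp
  qed
  also have "\<dots> = tangent_sum L a I z"
    unfolding tangent_sum_def using assms(1)
    by (intro sum.mono_neutral_cong_left) auto
  finally show ?thesis by simp
qed

text \<open>
The case where \<open>C\<close> is not a subspace and \<open>z\<close> is relatively interior to it is the classical relation
that the alternating number of faces vanishes.
\<close>

theorem euler_relation_tangent_cones:
  fixes C :: "'a::euclidean_space set"
  assumes "polyhedral_cone C"
  shows "(\<Sum>F\<in>cone_faces C. (-1) ^ dim F * indicator (C + span F) z)
    = ((-1) ^ dim C * indicator (rel_interior C) (- z) :: int)"
proof -
  obtain A where A: "finite A" "C = halfspace_cone UNIV (\<lambda>v. v) A"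
    using polyhedral_cone_halfspaces[OF assms] .
  show ?thesis
    using tangent_sum_eq_sum_faces[OF A(1) subspace_UNIV, of "\<lambda>v. v" z]
      tangent_sum_eq_signed_interior[OF A(1) subspace_UNIV, of "\<lambda>v. v" z]
    by (simp add: A(2)[symmetric] signed_interior_def)
qed

lemma polyhedral_cone_faces:
  fixes C :: "'a::euclidean_space set"
  assumes "polyhedral_cone C"
  shows "convex_cone C" "closed C" "finite (cone_faces C)"
    "\<And>x. x \<in> C \<Longrightarrow> \<exists>F\<in>cone_faces C. x \<in> rel_interior F"
proof -
  obtain A where A: "finite A" "C = halfspace_cone UNIV (\<lambda>v. v) A"
    using polyhedral_cone_halfspaces[OF assms] .
  show "convex_cone C"
    unfolding A(2) by (rule convex_cone_halfspace_cone[OF subspace_UNIV])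
  have "C = (\<Inter>v\<in>A. {x. v \<bullet> x \<ge> 0})"
    by (auto simp: A(2) halfspace_cone_def)
  then show "closed C"
    by (simp add: closed_INT closed_halfspace_ge)
  have "finite {J \<in> Pow A. open_cell UNIV (\<lambda>v. v) A J \<noteq> {}}"
    using A(1) by simp
  then show "finite (cone_faces C)"
    using bij_betw_finite[OF bij_betw_active_face[OF A(1) subspace_UNIV, of "\<lambda>v. v"]] A(2) by simp
  fix x assume "x \<in> C"
  let ?J = "{v \<in> A. v \<bullet> x = 0}"
  have "?J \<subseteq> A" by blast
  have cell: "x \<in> open_cell UNIV (\<lambda>v. v) A ?J"
    using mem_open_cell_active[of x UNIV "\<lambda>v. v" A] \<open>x \<in> C\<close> A(2) by blast
  have "active_face UNIV (\<lambda>v. v) A ?J face_of C"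
    unfolding A(2) by (rule active_face_face_of[OF A(1) subspace_UNIV \<open>?J \<subseteq> A\<close>])
  moreover have "x \<in> rel_interior (active_face UNIV (\<lambda>v. v) A ?J)"
    using open_cell_subset_rel_interior[OF A(1) subspace_UNIV \<open>?J \<subseteq> A\<close>] cell by blast
  ultimately show "\<exists>F\<in>cone_faces C. x \<in> rel_interior F"
    unfolding cone_faces_def using rel_interior_subset by blast
qed

section \<open>Faces of a tangent cone\<close>

lemma cone_facesD:
  assumes "convex_cone C" "F \<in> cone_faces C"
  shows "F face_of C" "convex_cone F" "F \<subseteq> C" "0 \<in> F"
proof -
  show face: "F face_of C" using assms(2) by (simp add: cone_faces_def)
  show cone: "convex_cone F"
    using assms face_of_conic[OF _ face] face_of_imp_convex[OF face]
    by (simp add: convex_cone_def cone_faces_def)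
  show "F \<subseteq> C" by (rule face_of_imp_subset[OF face])
  show "0 \<in> F" by (rule convex_cone_contains_0[OF cone])
qed

text \<open>
The sum \<open>u + v\<close> is the midpoint of the points \<open>2 *\<^sub>R u\<close> and \<open>2 *\<^sub>R v\<close> of the cone.
\<close>

lemma cone_face_summand:
  assumes C: "convex_cone C" and F: "F \<in> cone_faces C" and "u \<in> C" "v \<in> C" "u + v \<in> F"
  shows "u \<in> F"
proof -
  note F = cone_facesD[OF C F]
  have "2 *\<^sub>R u \<in> F"
  proof (cases "u = v")
    case True
    then show ?thesis using assms(5) by (simp add: scaleR_2)
  next
    case False
    then have "midpoint (2 *\<^sub>R u) (2 *\<^sub>R v) \<in> open_segment (2 *\<^sub>R u) (2 *\<^sub>R v)"
      by simp
    moreover have "midpoint (2 *\<^sub>R u) (2 *\<^sub>R v) = u + v"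
      by (simp add: midpoint_def scaleR_add_right)
    ultimately show ?thesis
      using face_ofD[OF F(1), of "u + v" "2 *\<^sub>R u" "2 *\<^sub>R v"] assms(3,4,5)
      by (simp add: convex_cone_scaleR[OF C])
  qed
  then show ?thesis
    using convex_cone_scaleR[OF F(2), of "1 / 2" "2 *\<^sub>R u"] by simp
qed

lemma span_convex_coneE:
  assumes C: "convex_cone C" and v: "v \<in> span C"
  obtains p q where "p \<in> C" "q \<in> C" "v = p - q"
proof -
  let ?D = "{p - q |p q. p \<in> C \<and> q \<in> C}"
  have "subspace ?D"
    unfolding subspace_def
  proof (intro conjI ballI allI)
    show "0 \<in> ?D" using convex_cone_contains_0[OF C] by force
  next
    fix x y assume "x \<in> ?D" "y \<in> ?D"
    then obtain p q r s where "p \<in> C" "q \<in> C" "x = p - q" "r \<in> C" "s \<in> C" "y = r - s" by blast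
    then have "x + y = (p + r) - (q + s)" "p + r \<in> C" "q + s \<in> C"
      by (simp_all add: convex_cone_add[OF C])
    then show "x + y \<in> ?D" by blast
  next
    fix c and x assume "x \<in> ?D"
    then obtain p q where pq: "p \<in> C" "q \<in> C" "x = p - q" by blast
    show "c *\<^sub>R x \<in> ?D"
    proof (cases "0 \<le> c")
      case True
      then have "c *\<^sub>R x = c *\<^sub>R p - c *\<^sub>R q" "c *\<^sub>R p \<in> C" "c *\<^sub>R q \<in> C"
        using pq by (simp_all add: convex_cone_scaleR[OF C] scaleR_diff_right)
      then show ?thesis by blast
    next
      case False
      then have "c *\<^sub>R x = (- c) *\<^sub>R q - (- c) *\<^sub>R p" "(- c) *\<^sub>R p \<in> C" "(- c) *\<^sub>R q \<in> C"
        using pq convex_cone_scaleR[OF C, of "- c"] by (simp_all add: scaleR_diff_right)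
      then show ?thesis by blast
    qed
  qed
  moreover have "C \<subseteq> ?D" using convex_cone_contains_0[OF C] by force
  ultimately have "span C \<subseteq> ?D" by (rule span_minimal[rotated])
  then show ?thesis using v that by blast
qed

lemma subset_plus_span: "S \<subseteq> S + span F"
  by (metis add.right_neutral set_plus_intro span_zero subsetI)

lemma span_plus_span:
  assumes "F \<subseteq> K"
  shows "span (K + span F) = span K"
proof
  show "span (K + span F) \<subseteq> span K"
    using span_mono[OF assms] by (intro span_minimal) (auto simp: set_plus_def intro!: span_add intro: span_base)
  show "span K \<subseteq> span (K + span F)"
    by (rule span_mono[OF subset_plus_span])
qed

lemma plus_span_plus_span:
  assumes "F \<subseteq> K"
  shows "C + span F + span K = C + span K"
proof -
  have "span F + span K = span K"
  proof
    show "span F + span K \<subseteq> span K"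
      using span_mono[OF assms] by (auto simp: set_plus_def intro!: span_add)
    show "span K \<subseteq> span F + span K"
      by (metis subset_plus_span add.commute)
  qed
  then show ?thesis by (simp add: add.assoc)
qed

text \<open>
Both claims come from one absorption property: a point of \<open>C\<close> that falls into \<open>K + span F\<close> after
adding a vector of \<open>span F\<close> is already in \<open>K\<close>.  Indeed \<open>span F\<close> consists of differences of points
of \<open>F\<close>, and moving the subtracted points to the other side exhibits the point as a summand of a point
of the face \<open>K\<close>.
\<close>

lemma face_plus_span:
  fixes C :: "'a::euclidean_space set"
  assumes C: "convex_cone C" and F: "F \<in> cone_faces C" and K: "K \<in> cone_faces C" "F \<subseteq> K"
  shows "K + span F \<in> cone_faces (C + span F)" "(K + span F) \<inter> C = K"
proof -
  note Ff = cone_facesD[OF C F] and Kf = cone_facesD[OF C K(1)]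
  have absorb: "c \<in> K" if cf: "c + f \<in> K + span F" "c \<in> C" "f \<in> span F" for c f
  proof -
    obtain k s where ks: "c + f = k + s" "k \<in> K" "s \<in> span F"
      using cf(1) by (rule set_plus_elim)
    have "s - f \<in> span F" using ks cf by (simp add: span_diff)
    then obtain p q where pq: "p \<in> F" "q \<in> F" "s - f = p - q"
      by (rule span_convex_coneE[OF Ff(2)])
    have "c + q = (c + f) - f + q" by simp
    also have "\<dots> = k + (s - f) + q" using ks(1) by simp
    also have "\<dots> = k + p" using pq(3) by simp
    finally have "c + q = k + p" .
    moreover have "k + p \<in> K" using ks(2) pq(1) K(2) convex_cone_add[OF Kf(2)] by blast
    moreover have "q \<in> C" using pq(2) Ff(3) by blast
    ultimately show ?thesis using cone_face_summand[OF C K(1) cf(2)] by metis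
  qed
  show "(K + span F) \<inter> C = K"
    using absorb[of _ 0] Kf(3) subset_plus_span[of K F] by (auto simp: span_zero)
  have "(K + span F) face_of (C + span F)"
    unfolding face_of_def
  proof (intro conjI ballI impI)
    show "K + span F \<subseteq> C + span F" using Kf(3) by (rule set_plus_mono2) simp
    show "convex (K + span F)"
      using Kf(2) by (intro convex_set_plus) (auto simp: convex_cone_def subspace_imp_convex)
    fix d1 d2 x
    assume "d1 \<in> C + span F" "d2 \<in> C + span F" and x: "x \<in> K + span F" "x \<in> open_segment d1 d2"
    then obtain c1 s1 c2 s2 where d: "d1 = c1 + s1" "c1 \<in> C" "s1 \<in> span F"
      "d2 = c2 + s2" "c2 \<in> C" "s2 \<in> span F"
      by (meson set_plus_elim)
    obtain u where u: "0 < u" "u < 1" "x = (1 - u) *\<^sub>R d1 + u *\<^sub>R d2"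
      using x(2) by (auto simp: in_segment)
    let ?k1 = "(1 - u) *\<^sub>R c1" and ?k2 = "u *\<^sub>R c2"
    have k: "?k1 \<in> C" "?k2 \<in> C"
      using u d by (auto intro: convex_cone_scaleR[OF C])
    have "x = (?k1 + ?k2) + ((1 - u) *\<^sub>R s1 + u *\<^sub>R s2)"
      using u(3) d by (simp add: algebra_simps)
    moreover have "(1 - u) *\<^sub>R s1 + u *\<^sub>R s2 \<in> span F"
      using d by (intro span_add span_scale)
    ultimately have "?k1 + ?k2 \<in> K"
      using absorb[of "?k1 + ?k2"] x(1) convex_cone_add[OF C k] by simp
    then have "?k1 \<in> K" "?k2 \<in> K"
      using cone_face_summand[OF C K(1)] k by (auto simp: add.commute)
    moreover have "v \<in> K" if "t *\<^sub>R v \<in> K" "0 < t" for t v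
      using convex_cone_scaleR[OF Kf(2), of "inverse t" "t *\<^sub>R v"] that by simp
    ultimately have "c1 \<in> K" "c2 \<in> K" using u(1,2) by auto
    then show "d1 \<in> K + span F" "d2 \<in> K + span F"
      using d by (auto intro: set_plus_intro)
  qed
  then show "K + span F \<in> cone_faces (C + span F)"
    using Kf(4) subset_plus_span[of K F] by (auto simp: cone_faces_def)
qed

text \<open>
Every nonempty face of a cone contains all linear subspaces contained in the cone, so \<open>span F \<subseteq> H\<close>.
\<close>

lemma face_of_plus_span:
  fixes C :: "'a::euclidean_space set"
  assumes C: "convex_cone C" and F: "F \<in> cone_faces C" and H: "H \<in> cone_faces (C + span F)"
  shows "H \<inter> C \<in> cone_faces C" "F \<subseteq> H \<inter> C" "H = (H \<inter> C) + span F"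
proof -
  note Ff = cone_facesD[OF C F]
  have D: "convex_cone (C + span F)"
  proof -
    have "C + span F = (\<Union>x\<in>C. \<Union>y\<in>span F. {x + y})" by (auto simp: set_plus_def)
    then show ?thesis using convex_cone_sums[OF C convex_cone_span] by simp
  qed
  note Hf = cone_facesD[OF D H]
  have span: "s \<in> H" if "s \<in> span F" for s
  proof (rule cone_face_summand[OF D H])
    have "t \<in> C + span F" if "t \<in> span F" for t
      using that convex_cone_contains_0[OF C] by (metis add_0 set_plus_intro)
    then show "s \<in> C + span F" "- s \<in> C + span F"
      using that by (simp_all add: span_neg)
    show "s + - s \<in> H" using Hf(4) by simp
  qed
  have "(H \<inter> C) face_of (C + span F) \<inter> C"
    using C by (intro face_of_slice Hf(1)) (simp add: convex_cone_def)
  moreover have "(C + span F) \<inter> C = C" using subset_plus_span[of C F] by blast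
  ultimately show "H \<inter> C \<in> cone_faces C"
    using Hf(4) convex_cone_contains_0[OF C] by (auto simp: cone_faces_def)
  show "F \<subseteq> H \<inter> C" using span Ff(3) by (auto intro: span_base)
  show "H = (H \<inter> C) + span F"
  proof
    show "H \<subseteq> (H \<inter> C) + span F"
    proof
      fix h assume h: "h \<in> H"
      then obtain c s where cs: "h = c + s" "c \<in> C" "s \<in> span F"
        using Hf(3) by (meson set_plus_elim subsetD)
      then have "h + - s \<in> H" using h span[of "- s"] convex_cone_add[OF Hf(2)] cs(3) by (blast intro: span_neg)
      then have "c \<in> H" using cs(1) by simp
      then show "h \<in> (H \<inter> C) + span F" using cs by (auto intro: set_plus_intro)
    qed
    show "(H \<inter> C) + span F \<subseteq> H"
      using span convex_cone_add[OF Hf(2)] by (auto simp: set_plus_def)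
  qed
qed

lemma bij_betw_faces_plus_span:
  fixes C :: "'a::euclidean_space set"
  assumes C: "convex_cone C" and F: "F \<in> cone_faces C"
  shows "bij_betw (\<lambda>K. K + span F) {K \<in> cone_faces C. F \<subseteq> K} (cone_faces (C + span F))"
proof (rule bij_betwI[where g = "\<lambda>H. H \<inter> C"])
  show "(\<lambda>K. K + span F) \<in> {K \<in> cone_faces C. F \<subseteq> K} \<rightarrow> cone_faces (C + span F)"
    using face_plus_span(1)[OF assms] by blast
  show "(\<lambda>H. H \<inter> C) \<in> cone_faces (C + span F) \<rightarrow> {K \<in> cone_faces C. F \<subseteq> K}"
    using face_of_plus_span(1,2)[OF assms] by blast
  show "(K + span F) \<inter> C = K" if "K \<in> {K \<in> cone_faces C. F \<subseteq> K}" for K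
    using face_plus_span(2)[OF assms] that by blast
  show "(H \<inter> C) + span F = H" if "H \<in> cone_faces (C + span F)" for H
    using face_of_plus_span(3)[OF assms that] by simp
qed

lemma psi_tangent_cone:
  fixes C :: "'a::euclidean_space set"
  assumes C: "convex_cone C" and F: "F \<in> cone_faces C"
  shows "psi X (C + span F) u l = (\<Sum>K\<in>{K \<in> cone_faces C. F \<subseteq> K}.
    (-1) ^ dim K * indicator (C + span K) u * indicator (dual_cone X (K + span F)) l)"
proof -
  have "psi X (C + span F) u l = (\<Sum>K\<in>{K \<in> cone_faces C. F \<subseteq> K}. (-1) ^ dim (K + span F)
      * indicator (C + span F + span (K + span F)) u * indicator (dual_cone X (K + span F)) l)"
    unfolding psi_def by (rule sum.reindex_bij_betw[OF bij_betw_faces_plus_span[OF assms], symmetric])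
  also have "\<dots> = (\<Sum>K\<in>{K \<in> cone_faces C. F \<subseteq> K}.
    (-1) ^ dim K * indicator (C + span K) u * indicator (dual_cone X (K + span F)) l)"
  proof (rule sum.cong[OF refl])
    fix K assume "K \<in> {K \<in> cone_faces C. F \<subseteq> K}"
    then have "F \<subseteq> K" by simp
    then have "dim (K + span F) = dim K" "C + span F + span (K + span F) = C + span K"
      using span_plus_span[of F K] plus_span_plus_span[of F K C] by (metis dim_span, simp)
    then show "(-1) ^ dim (K + span F) * indicator (C + span F + span (K + span F)) u
        * indicator (dual_cone X (K + span F)) l
      = (-1) ^ dim K * indicator (C + span K) u * (indicator (dual_cone X (K + span F)) l :: int)"
      by simp
  qed
  finally show ?thesis .
qed

section \<open>Orthogonal projections and nearest points\<close>

lemma orth_proj_eqI: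
  assumes "subspace Y" "y \<in> Y" "x - y \<in> Y\<^sup>\<bottom>"
  shows "orth_proj Y x = y"
  unfolding orth_proj_def
proof (rule the_equality)
  show "y \<in> Y \<and> x - y \<in> Y\<^sup>\<bottom>" using assms by simp
  fix w assume w: "w \<in> Y \<and> x - w \<in> Y\<^sup>\<bottom>"
  have "w - y \<in> Y" using w assms by (simp add: subspace_diff)
  moreover have "(x - y) - (x - w) \<in> Y\<^sup>\<bottom>"
    using subspace_diff[OF subspace_orthogonal_comp assms(3)] w by blast
  ultimately have "(w - y) \<bullet> (w - y) = 0"
    by (auto simp: orthogonal_comp_def orthogonal_def)
  then show "w = y" by simp
qed

lemma orth_proj_props:
  assumes "subspace Y"
  shows "orth_proj Y x \<in> Y" "x - orth_proj Y x \<in> Y\<^sup>\<bottom>"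
proof -
  obtain y z where "y \<in> span Y" "\<And>w. w \<in> span Y \<Longrightarrow> orthogonal z w" "x = y + z"
    by (rule orthogonal_subspace_decomp_exists[of Y x]) blast
  then have yz: "y \<in> Y" "x - y \<in> Y\<^sup>\<bottom>"
    using assms by (auto simp: span_eq_iff[THEN iffD2, OF assms] orthogonal_comp_def orthogonal_commute)
  show "orth_proj Y x \<in> Y" "x - orth_proj Y x \<in> Y\<^sup>\<bottom>"
    using orth_proj_eqI[OF assms yz] yz by simp_all
qed

lemma orth_proj_complement:
  assumes "subspace X" "x \<in> X" "span F \<subseteq> X"
  shows "orth_proj (X \<inter> (span F)\<^sup>\<bottom>) x = x - orth_proj (span F) x"
proof (rule orth_proj_eqI)
  note p = orth_proj_props[OF subspace_span[of F], of x]
  show "subspace (X \<inter> (span F)\<^sup>\<bottom>)"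
    by (intro subspace_inter assms(1) subspace_orthogonal_comp)
  show "x - orth_proj (span F) x \<in> X \<inter> (span F)\<^sup>\<bottom>"
    using p assms by (auto intro: subspace_diff)
  show "x - (x - orth_proj (span F) x) \<in> (X \<inter> (span F)\<^sup>\<bottom>)\<^sup>\<bottom>"
    using p(1) by (auto simp: orthogonal_comp_def orthogonal_commute)
qed

text \<open>
Testing the obtuse angle criterion for the nearest point with \<open>0\<close> and \<open>2 *\<^sub>R k\<close> splits it into the
orthogonality relation and the membership of \<open>k - x\<close> in the dual cone.
\<close>

lemma closest_point_cone:
  fixes K :: "'a::euclidean_space set"
  assumes K: "convex_cone K" "closed K"
  shows "closest_point K x = k \<longleftrightarrow> k \<in> K \<and> (x - k) \<bullet> k = 0 \<and> (\<forall>v\<in>K. (x - k) \<bullet> v \<le> 0)"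
proof
  have conv: "convex K" and ne: "K \<noteq> {}" using K by (auto simp: convex_cone_def)
  show "k \<in> K \<and> (x - k) \<bullet> k = 0 \<and> (\<forall>v\<in>K. (x - k) \<bullet> v \<le> 0)" if k: "closest_point K x = k"
  proof -
    have "k \<in> K" using closest_point_in_set[OF K(2) ne] k by blast
    have dot: "(x - k) \<bullet> (v - k) \<le> 0" if "v \<in> K" for v
      using closest_point_dot[OF conv K(2) that, of x] k by simp
    have "(x - k) \<bullet> k \<le> 0"
      using dot[of "2 *\<^sub>R k"] convex_cone_scaleR[OF K(1) _ \<open>k \<in> K\<close>, of 2] by (simp add: scaleR_2)
    moreover have "0 \<le> (x - k) \<bullet> k"
      using dot[of 0] convex_cone_contains_0[OF K(1)] by simp
    ultimately have "(x - k) \<bullet> k = 0" by simp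
    then show ?thesis
      using \<open>k \<in> K\<close> dot by (simp add: inner_diff_right)
  qed
  show "closest_point K x = k" if k: "k \<in> K \<and> (x - k) \<bullet> k = 0 \<and> (\<forall>v\<in>K. (x - k) \<bullet> v \<le> 0)"
  proof -
    have "dist x k \<le> dist x z" if "z \<in> K" for z
    proof -
      have "norm (x - z) ^ 2 = norm (x - k) ^ 2 - 2 * ((x - k) \<bullet> (z - k)) + norm (z - k) ^ 2"
        by (simp add: power2_norm_eq_inner algebra_simps inner_commute)
      moreover have "(x - k) \<bullet> (z - k) \<le> 0"
        using k that by (simp add: inner_diff_right)
      ultimately have "norm (x - k) ^ 2 \<le> norm (x - z) ^ 2"
        using zero_le_power2[of "norm (z - k)"] by linarith
      then show ?thesis by (simp add: dist_norm power2_le_iff_abs_le)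
    qed
    then show ?thesis
      using k closest_point_unique[OF conv K(2), of k x] by metis
  qed
qed

text \<open>
If \<open>orth_proj (span F) x\<close> is in \<open>F\<close> and its difference to \<open>x\<close> is in the dual cone, it satisfies the
characterization of the nearest point \<open>k\<close>.  Conversely, if \<open>k\<close> is in the relative interior of \<open>F\<close>,
then \<open>x - k\<close>, as a functional, is nonpositive on \<open>F\<close> and attains its maximum \<open>0\<close> at a relative
interior point; so it vanishes on \<open>span F\<close>, and \<open>k\<close> is the projection.
\<close>

lemma closest_point_in_face_iff:
  fixes K :: "'a::euclidean_space set"
  assumes K: "convex_cone K" "closed K" and F: "F \<in> cone_faces K"
    and X: "subspace X" "K \<subseteq> X" "x \<in> X"
  shows "- orth_proj (X \<inter> (span F)\<^sup>\<bottom>) x \<in> dual_cone X (K + span F)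
      \<and> orth_proj (span F) x \<in> rel_interior F
    \<longleftrightarrow> closest_point K x \<in> rel_interior F"
proof -
  note Ff = cone_facesD[OF K(1) F]
  let ?p = "orth_proj (span F) x"
  have p: "?p \<in> span F" "x - ?p \<in> (span F)\<^sup>\<bottom>"
    by (rule orth_proj_props[OF subspace_span])+
  have spanX: "span F \<subseteq> X" using Ff(3) X by (meson order_trans span_minimal)
  have n: "- orth_proj (X \<inter> (span F)\<^sup>\<bottom>) x = ?p - x"
    by (simp add: orth_proj_complement[OF X(1,3) spanX])
  show ?thesis
    unfolding n
  proof (intro iffI conjI; (elim conjE)?)
    assume dual: "?p - x \<in> dual_cone X (K + span F)" and ri: "?p \<in> rel_interior F"
    have "?p \<in> K" using ri Ff(3) rel_interior_subset by blast
    moreover have "(x - ?p) \<bullet> ?p = 0"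
      using p by (auto simp: orthogonal_comp_def orthogonal_def inner_commute)
    moreover have "(x - ?p) \<bullet> v \<le> 0" if "v \<in> K" for v
    proof -
      have "v \<in> K + span F" using that subset_plus_span by blast
      then have "0 \<le> (?p - x) \<bullet> v" using dual by (simp add: dual_cone_def)
      then show ?thesis by (simp add: inner_diff_left)
    qed
    ultimately have "closest_point K x = ?p" using closest_point_cone[OF K] by blast
    then show "closest_point K x \<in> rel_interior F" using ri by simp
  next
    define k where "k = closest_point K x"
    assume ri: "closest_point K x \<in> rel_interior F"
    have k: "k \<in> rel_interior F" "(x - k) \<bullet> k = 0" "\<And>v. v \<in> K \<Longrightarrow> (x - k) \<bullet> v \<le> 0"
      using ri closest_point_cone[OF K, of x k] by (auto simp: k_def)
    have kF: "k \<in> F" using k(1) rel_interior_subset by blast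
    have convF: "convex F" using Ff(2) by (simp add: convex_cone_def)
    have zero: "(x - k) \<bullet> f = 0" if f: "f \<in> F" for f
    proof -
      obtain e where e: "e > 1" "(1 - e) *\<^sub>R f + e *\<^sub>R k \<in> F"
        using convex_rel_interior_iff[OF convF, of k] k(1) f by blast
      have "(x - k) \<bullet> ((1 - e) *\<^sub>R f + e *\<^sub>R k) \<le> 0"
        using k(3) e(2) Ff(3) by blast
      then have "(1 - e) * ((x - k) \<bullet> f) \<le> 0"
        using k(2) by (simp add: inner_add_right)
      then have "0 \<le> (x - k) \<bullet> f"
        using e(1) by (simp add: mult_le_0_iff)
      then show ?thesis using k(3)[of f] f Ff(3) by force
    qed
    have zero_span: "(x - k) \<bullet> s = 0" if "s \<in> span F" for s
      using that by (induction rule: span_induct) (auto simp: zero subspace_def inner_add_right)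
    then have "x - k \<in> (span F)\<^sup>\<bottom>"
      by (simp add: orthogonal_comp_def orthogonal_def inner_commute)
    then have pk: "?p = k"
      using kF by (intro orth_proj_eqI) (auto intro: span_base)
    then show "?p \<in> rel_interior F" using k(1) by simp
    show "?p - x \<in> dual_cone X (K + span F)"
      unfolding pk dual_cone_def
    proof (intro CollectI conjI ballI)
      show "k - x \<in> X" using kF Ff(3) X by (auto intro: subspace_diff)
      fix z assume "z \<in> K + span F"
      then obtain v s where vs: "z = v + s" "v \<in> K" "s \<in> span F" by (rule set_plus_elim)
      then have "(x - k) \<bullet> z \<le> 0"
        using zero_span k(3) by (simp add: inner_add_right)
      then show "0 \<le> (k - x) \<bullet> z" by (simp add: inner_diff_left)
    qed
  qed
qed

section \<open>The identity\<close>

lemma cone_faces_subset_iff: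
  assumes "K \<in> cone_faces C"
  shows "F \<in> cone_faces K \<longleftrightarrow> F \<in> cone_faces C \<and> F \<subseteq> K"
  using assms face_of_face[of K C F] by (auto simp: cone_faces_def)

text \<open>
The nearest point of \<open>K\<close> lies in the relative interior of exactly one face, which is then contained
in \<open>K\<close>; only this face contributes.
\<close>

lemma sum_nearest_point_faces:
  fixes C :: "'a::euclidean_space set"
  assumes C: "polyhedral_cone C" and X: "subspace X" "C \<subseteq> X" "x \<in> X" and K: "K \<in> cone_faces C"
  shows "(\<Sum>F\<in>{F \<in> cone_faces C. F \<subseteq> K}.
      indicator (dual_cone X (K + span F)) (- orth_proj (X \<inter> (span F)\<^sup>\<bottom>) x)
      * indicator (rel_interior F) (orth_proj (span F) x)) = (1 :: int)"
proof -
  note Cp = polyhedral_cone_faces[OF C]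
  note Kf = cone_facesD[OF Cp(1) K]
  have clK: "closed K"
    using face_of_imp_closed[OF _ Cp(2) Kf(1)] Cp(1) by (simp add: convex_cone_def)
  define k where "k = closest_point K x"
  have kK: "k \<in> K"
    unfolding k_def using clK Kf(4) by (intro closest_point_in_set) auto
  then obtain G where G: "G \<in> cone_faces C" "k \<in> rel_interior G"
    using Cp(4)[of k] Kf(3) by blast
  have GK: "G \<subseteq> K"
    using G kK cone_facesD(3)[OF Cp(1) G(1)] by (intro subset_of_face_of[OF Kf(1)]) auto
  have unique: "F = G" if "F \<in> cone_faces C" "k \<in> rel_interior F" for F
    using that G by (intro face_of_eq[of _ C]) (auto simp: cone_faces_def)
  have "(\<Sum>F\<in>{F \<in> cone_faces C. F \<subseteq> K}.
      indicator (dual_cone X (K + span F)) (- orth_proj (X \<inter> (span F)\<^sup>\<bottom>) x)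
      * indicator (rel_interior F) (orth_proj (span F) x))
    = (\<Sum>F\<in>{F \<in> cone_faces C. F \<subseteq> K}. if F = G then 1 else (0 :: int))"
  proof (rule sum.cong[OF refl])
    fix F assume F: "F \<in> {F \<in> cone_faces C. F \<subseteq> K}"
    then have "F \<in> cone_faces K"
      using cone_faces_subset_iff[OF K] by blast
    from closest_point_in_face_iff[OF Kf(2) clK this X(1) _ X(3)]
    have "- orth_proj (X \<inter> (span F)\<^sup>\<bottom>) x \<in> dual_cone X (K + span F)
        \<and> orth_proj (span F) x \<in> rel_interior F \<longleftrightarrow> F = G"
      using unique[of F] F G(2) Kf(3) X(2) by (auto simp: k_def)
    then show "indicator (dual_cone X (K + span F)) (- orth_proj (X \<inter> (span F)\<^sup>\<bottom>) x)
      * indicator (rel_interior F) (orth_proj (span F) x) = (if F = G then 1 else (0 :: int))"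
      by (auto simp: indicator_def)
  qed
  also have "\<dots> = 1"
    using G GK Cp(3) by simp
  finally show ?thesis .
qed

theorem lemmaB1:
  fixes X C :: "'a::euclidean_space set" and x y :: 'a
  assumes "subspace X"
    and "C \<subseteq> X"
    and "polyhedral_cone C"
    and "x \<in> X"
    and "y \<in> X"
  shows "(\<Sum>F\<in>cone_faces C.
            psi X (C + span F) (- y) (- orth_proj (X \<inter> (span F)\<^sup>\<bottom>) x)
            * indicator (rel_interior F) (orth_proj (span F) x))
         = (-1) ^ dim C * indicator (rel_interior C) y"
proof -
  note Cp = polyhedral_cone_faces[OF assms(3)]
  let ?T = "\<lambda>K. (-1) ^ dim K * indicator (C + span K) (- y) :: int"
  let ?M = "\<lambda>F K. indicator (dual_cone X (K + span F)) (- orth_proj (X \<inter> (span F)\<^sup>\<bottom>) x)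
      * indicator (rel_interior F) (orth_proj (span F) x) :: int"
  have "(\<Sum>F\<in>cone_faces C. psi X (C + span F) (- y) (- orth_proj (X \<inter> (span F)\<^sup>\<bottom>) x)
            * indicator (rel_interior F) (orth_proj (span F) x))
      = (\<Sum>F\<in>cone_faces C. \<Sum>K\<in>{K \<in> cone_faces C. F \<subseteq> K}. ?T K * ?M F K)"
    by (intro sum.cong refl) (simp add: psi_tangent_cone[OF Cp(1)] sum_distrib_right mult.assoc)
  also have "\<dots> = (\<Sum>K\<in>cone_faces C. \<Sum>F\<in>{F \<in> cone_faces C. F \<subseteq> K}. ?T K * ?M F K)"
    by (rule sum.swap_restrict[OF Cp(3) Cp(3)])
  also have "\<dots> = (\<Sum>K\<in>cone_faces C. ?T K)"
    by (intro sum.cong refl)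
      (simp add: sum_distrib_left[symmetric] sum_nearest_point_faces[OF assms(3,1,2,4)])
  also have "\<dots> = (-1) ^ dim C * indicator (rel_interior C) y"
    using euler_relation_tangent_cones[OF assms(3), of "- y"] by simp
  finally show ?thesis .
qed

end
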